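(* Let $N\geqslant 2$ be an integer. For all $p,q\in\mathbb{N}$ there exist a constant $C_{p,q}>0$ and, for every integer $n\geqslant p+q$, a scalar $\alpha_{p,q}^n\in\mathbb{C}$ with $$C_{p,q}\leqslant|\alpha_{p,q}^n|\leqslant 1,$$ such that the following holds for all $n\geqslant p+q$. Let $\zeta\in H_{p+q}$ be decomposed as $\zeta=\sum\zeta^{(1)}\otimes\zeta^{(2)}\in H_p\otimes H_q$ and as $\zeta=\sum\zeta_{(1)}\otimes\zeta_{(2)}\in H_q\otimes H_p$. Then $$\sum(\overline{\zeta}^{(1)*}\otimes\mathrm{id}_{n-p})P_n(\zeta^{(2)}\otimes\mathrm{id}_{n-q})=\alpha_{p,q}^n\sum P_{n-p}(\zeta_{(1)}\overline{\zeta}_{(2)}^{*}\otimes\mathrm{id}_{n-p-q})P_{n-q},$$ $$\sum(\mathrm{id}_{n-p}\otimes\zeta^{(1)*})P_n(\mathrm{id}_{n-q}\otimes\overline{\zeta}^{(2)})=\alpha_{p,q}^n\sum P_{n-p}(\mathrm{id}_{n-p-q}\otimes\overline{\zeta}_{(1)}\zeta_{(2)}^{*})P_{n-q},$$ as operators from $H_{n-q}$ to $H_{n-p}$.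
   Context: Let $H_1=\mathbb{C}^N$ with canonical orthonormal basis $(e_i)_{1\leqslant i\leqslant N}$, and let $t_1=\sum_{i=1}^N e_i\otimes e_i\in H_1\otimes H_1$, also viewed as a map $t_1:\mathbb{C}\to H_1\otimes H_1$. Let $O_N^+$ be the free orthogonal quantum group: $C(O_N^+)$ is the universal unital C*-algebra generated by $N^2$ self-adjoint elements $u_{ij}$ such that $u=(u_{ij})$ is unitary, with coproduct $\Delta(u_{ij})=\sum_k u_{ik}\otimes u_{kj}$. Its irreducible representations (Banica) are $(u^n)_{n\in\mathbb{N}}$, with $u^0$ trivial, $u^1=u$ and $u^1\otimes u^n\simeq u^{n+1}\oplus u^{n-1}$ for $n\geqslant 1$. For $n\in\mathbb{N}$, $H_n\subset H_1^{\otimes n}$ is the unique subspace on which $u^{\otimes n}$ restricts to a representation equivalent to $u^n$ ($H_0=\mathbb{C}$); equivalently, $H_n$ is the set of vectors of $H_1^{\otimes n}$ annihilated by all maps $\mathrm{id}_1^{\otimes i}\otimes t_1^*\otimes \mathrm{id}_1^{\otimes (n-i-2)}$, $0\leqslant i\leqslant n-2$. $P_n$ is the orthogonal projection of $H_1^{\otimes n}$ onto $H_n$ (Jones-Wenzl projection), and $\mathrm{id}_n$ is the identity of $H_n$. For $a+b=n$ one has $H_n\subset H_a\otimes H_b$, and $P_n$ is also viewed as an element of $\mathcal{B}(H_a\otimes H_b)$. Scalar products are linear in the first variable. A vector $\xi\in H$ is identified with the map $\mathbb{C}\to H$, $1\mapsto\xi$, and $\xi^*:H\to\mathbb{C}$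 is its adjoint $\langle\,\cdot\,,\xi\rangle$. For $\zeta\in H_n$, $\overline\zeta=j_n(\zeta)\in H_n$, where $j_n:H_n\to H_n$ is the conjugate-linear unitary determined by $t_n^*(\zeta\otimes\mathrm{id}_n)=\overline\zeta^{*}$, with $t_n=(P_n\otimes P_n)(t_1)_{1,2n}(t_1)_{2,2n-1}\cdots(t_1)_{n,n+1}\in H_n\otimes H_n$ (the indices indicate the tensor legs occupied by each copy of $t_1$); explicitly, $j_n$ is the restriction to $H_n$ of the conjugate-linear map $x_1\otimes\cdots\otimes x_n\mapsto\overline{x_n}\otimes\cdots\otimes\overline{x_1}$ on $H_1^{\otimes n}$, where $\overline{x}$ is coordinatewise complex conjugation on $\mathbb{C}^N$. Sums are in Sweedler-type notation; $\overline{\zeta}^{(i)}$ and $\overline\zeta_{(i)}$ denote $\overline{\zeta^{(i)}}$ and $\overline{\zeta_{(i)}}$. *)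

theory Defs
  imports Complex_Main "HOL-Library.Function_Algebras"
begin

text \<open>
  A tensor is given by its coordinates in the word basis: the word \<open>[i\<^sub>1, ..., i\<^sub>n]\<close> over the
  letters \<open>0, ..., N - 1\<close> stands for \<open>e\<^sub>i\<^sub>1 \<otimes> ... \<otimes> e\<^sub>i\<^sub>n\<close>. The tensor power \<open>H\<^sub>1\<^sup>\<otimes>\<^sup>n\<close> is the set of tensors
  supported on words of length \<open>n\<close>, and \<open>H\<^sub>1\<^sup>\<otimes>\<^sup>0 = \<complex>\<close> is spanned by the empty word.
  Sums and differences of tensors, and sums of operators, are the pointwise ones of
  Function\_Algebras.
\<close>

type_synonym tens = "nat list \<Rightarrow> complex"

definition words :: "nat \<Rightarrow> nat \<Rightarrow> nat list set" where
  "words N n = {w. length w = n \<and> set w \<subseteq> {..<N}}"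

definition tpow :: "nat \<Rightarrow> nat \<Rightarrow> tens set" where
  "tpow N n = {v. \<forall>w. w \<notin> words N n \<longrightarrow> v w = 0}"

definition wbasis :: "nat list \<Rightarrow> tens" where
  "wbasis u = (\<lambda>w. if w = u then 1 else 0)"

definition scale :: "complex \<Rightarrow> tens \<Rightarrow> tens" where
  "scale c v = (\<lambda>w. c * v w)"

text \<open>
  The product of the tensor algebra of \<open>\<complex>\<^sup>N\<close>. If \<open>x\<close> has degree \<open>a\<close>, only the summand \<open>k = a\<close>
  survives.
\<close>

definition tprod :: "tens \<Rightarrow> tens \<Rightarrow> tens" (infixr "\<otimes>\<^sub>t" 75) where
  "x \<otimes>\<^sub>t y = (\<lambda>w. \<Sum>k\<le>length w. x (take k w) * y (drop k w))"

definition tinner :: "nat \<Rightarrow> nat \<Rightarrow> tens \<Rightarrow> tens \<Rightarrow> complex" where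
  "tinner N n x y = (\<Sum>w\<in>words N n. x w * cnj (y w))"

text \<open>
  \<open>op_tensor N a c S T\<close> is \<open>S \<otimes> T\<close> for linear \<open>S\<close> defined on \<open>H\<^sub>1\<^sup>\<otimes>\<^sup>a\<close> and linear \<open>T\<close> defined on
  \<open>H\<^sub>1\<^sup>\<otimes>\<^sup>c\<close>: the linear map on \<open>H\<^sub>1\<^sup>\<otimes>\<^sup>a\<^sup>+\<^sup>c\<close> with \<open>e\<^sub>u \<otimes> e\<^sub>w \<mapsto> S e\<^sub>u \<otimes> T e\<^sub>w\<close>.
\<close>

definition op_tensor ::
  "nat \<Rightarrow> nat \<Rightarrow> nat \<Rightarrow> (tens \<Rightarrow> tens) \<Rightarrow> (tens \<Rightarrow> tens) \<Rightarrow> tens \<Rightarrow> tens" where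
  "op_tensor N a c S T v =
     (\<Sum>u\<in>words N a. \<Sum>w\<in>words N c. scale (v (u @ w)) (S (wbasis u) \<otimes>\<^sub>t T (wbasis w)))"

text \<open>
  The vector \<open>\<xi>\<close> of degree \<open>n\<close> as the map \<open>\<complex> \<rightarrow> H\<^sub>1\<^sup>\<otimes>\<^sup>n\<close>, \<open>1 \<mapsto> \<xi>\<close>, and its adjoint \<open>\<xi>\<^sup>*\<close>,
  \<open>v \<mapsto> \<langle>v, \<xi>\<rangle>\<close>, where \<open>\<complex>\<close> is the tensor power of degree 0.
\<close>

definition ket :: "tens \<Rightarrow> tens \<Rightarrow> tens" where
  "ket \<xi> c = scale (c []) \<xi>"

definition bra :: "nat \<Rightarrow> nat \<Rightarrow> tens \<Rightarrow> tens \<Rightarrow> tens" where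
  "bra N n \<xi> v = scale (tinner N n v \<xi>) (wbasis [])"

definition t1 :: "nat \<Rightarrow> tens" where
  "t1 N = (\<Sum>i<N. wbasis [i] \<otimes>\<^sub>t wbasis [i])"

text \<open>
  The representation space \<open>H\<^sub>n\<close> of \<open>O\<^sub>N\<^sup>+\<close>: the common kernel of the maps
  \<open>id\<^sub>1\<^sup>\<otimes>\<^sup>i \<otimes> t\<^sub>1\<^sup>* \<otimes> id\<^sub>1\<^sup>\<otimes>\<^sup>(\<^sup>n\<^sup>-\<^sup>i\<^sup>-\<^sup>2\<^sup>)\<close>.
\<close>

definition Hsp :: "nat \<Rightarrow> nat \<Rightarrow> tens set" where
  "Hsp N n = {v \<in> tpow N n. \<forall>i. i + 2 \<le> n \<longrightarrow>
     op_tensor N i (n - i) id (op_tensor N 2 (n - i - 2) (bra N 2 (t1 N)) id) v = 0}"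

text \<open>The orthogonal projection onto \<open>H\<^sub>n\<close>, meaningful for \<open>v \<in> tpow N n\<close>.\<close>

definition JW :: "nat \<Rightarrow> nat \<Rightarrow> tens \<Rightarrow> tens" where
  "JW N n v = (THE h. h \<in> Hsp N n \<and> (\<forall>k\<in>Hsp N n. tinner N n (v - h) k = 0))"

text \<open>
  The conjugate-linear extension of \<open>x\<^sub>1 \<otimes> ... \<otimes> x\<^sub>n \<mapsto> cnj x\<^sub>n \<otimes> ... \<otimes> cnj x\<^sub>1\<close>, in coordinates;
  its restriction to \<open>H\<^sub>n\<close> is \<open>j\<^sub>n\<close>.
\<close>

definition tconj :: "tens \<Rightarrow> tens" where
  "tconj v = (\<lambda>w. cnj (v (rev w)))"

text \<open>\<open>\<zeta> = \<Sum>\<^sub>k\<^sub><\<^sub>m x\<^sub>k \<otimes> y\<^sub>k\<close> is a decomposition of \<open>\<zeta>\<close> in \<open>H\<^sub>a \<otimes> H\<^sub>b\<close> (Sweedler notation).\<close>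

definition decomp ::
  "nat \<Rightarrow> nat \<Rightarrow> nat \<Rightarrow> tens \<Rightarrow> nat \<Rightarrow> (nat \<Rightarrow> tens) \<Rightarrow> (nat \<Rightarrow> tens) \<Rightarrow> bool" where
  "decomp N a b \<zeta> m x y \<longleftrightarrow>
     (\<forall>k<m. x k \<in> Hsp N a \<and> y k \<in> Hsp N b) \<and> \<zeta> = (\<Sum>k<m. x k \<otimes>\<^sub>t y k)"

end

theory Submission
  imports Defs
begin

text \<open>
  Contraction of the first leg with a basis vector maps \<open>H\<^sub>m\<close> to \<open>H\<^sub>m\<^sub>-\<^sub>1\<close>, and
  \<open>v \<mapsto> P\<^sub>m\<^sub>+\<^sub>1(e\<^sub>j \<otimes> v)\<close> is a creation operator. By the one-sided Wenzl recursion, on \<open>H\<^sub>m\<close> and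
  against trace-free coefficients a contraction following a creation equals \<open>-[m]/[m+1]\<close> (quantum
  integers with \<open>[2] = N\<close>) times the creation following the contraction. Both sides of the first
  identity are words in \<open>p\<close> contractions and \<open>q\<close> creations with coefficients \<open>\<zeta>\<close>, whose traces
  over neighbouring legs vanish since \<open>\<zeta> \<in> H\<^sub>p\<^sub>+\<^sub>q\<close>. Moving the contractions one by one through the
  creations takes \<open>p q\<close> swaps, so \<open>\<alpha>\<close> is a product of \<open>p q\<close> such factors, each of modulus between
  \<open>1/N\<close> and \<open>1\<close>. The second identity is the image of the first under the conjugate-linear
  reversal of the legs.
\<close>

section \<open>Words and sums over words\<close>

lemma sum_fun_app: "(\<Sum>a\<in>A. f a) x = (\<Sum>a\<in>A. f a x)"
  for f :: "'a \<Rightarrow> 'b \<Rightarrow> 'c::comm_monoid_add"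
  by (induction A rule: infinite_finite_induct) auto

lemma finite_words [simp]: "finite (words N n)"
proof -
  have "words N n = {w. set w \<subseteq> {..<N} \<and> length w = n}"
    by (auto simp: words_def)
  then show ?thesis by (simp add: finite_lists_length_eq)
qed

lemma words_0 [simp]: "words N 0 = {[]}"
  by (auto simp: words_def)

lemma length_words: "w \<in> words N n \<Longrightarrow> length w = n"
  by (simp add: words_def)

lemma Cons_in_words [simp]: "i # w \<in> words N (Suc n) \<longleftrightarrow> i < N \<and> w \<in> words N n"
  by (auto simp: words_def)

lemma append_in_words: "length u = a \<Longrightarrow> u @ w \<in> words N (a + b) \<longleftrightarrow> u \<in> words N a \<and> w \<in> words N b"
  by (auto simp: words_def)

lemma rev_in_words [simp]: "rev w \<in> words N n \<longleftrightarrow> w \<in> words N n"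
  by (auto simp: words_def)

lemma sum_words_append:
  "(\<Sum>w\<in>words N (a + b). f w) = (\<Sum>u\<in>words N a. \<Sum>w\<in>words N b. f (u @ w))"
  for f :: "nat list \<Rightarrow> 'c::comm_monoid_add"
proof -
  have "(\<Sum>w\<in>words N (a + b). f w) = (\<Sum>(u, w)\<in>words N a \<times> words N b. f (u @ w))"
    by (rule sum.reindex_bij_witness[of _ "\<lambda>(u, w). u @ w" "\<lambda>w. (take a w, drop a w)"])
      (auto simp: words_def dest: in_set_takeD in_set_dropD)
  then show ?thesis by (simp add: sum.cartesian_product)
qed

lemma sum_words_1: "(\<Sum>w\<in>words N (Suc 0). f w) = (\<Sum>i<N. f [i])"
  for f :: "nat list \<Rightarrow> 'c::comm_monoid_add"
  by (rule sum.reindex_bij_witness[of _ "\<lambda>i. [i]" hd]) (auto simp: words_def length_Suc_conv)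

lemma sum_words_Suc:
  "(\<Sum>w\<in>words N (Suc n). f w) = (\<Sum>i<N. \<Sum>w\<in>words N n. f (i # w))"
  for f :: "nat list \<Rightarrow> 'c::comm_monoid_add"
  using sum_words_append[of f N 1 n] by (simp add: sum_words_1)

lemma sum_words_rev: "(\<Sum>w\<in>words N n. f (rev w)) = (\<Sum>w\<in>words N n. f w)"
  for f :: "nat list \<Rightarrow> 'c::comm_monoid_add"
  by (rule sum.reindex_bij_witness[of _ rev rev]) auto

section \<open>Homogeneous tensors and the tensor product in coordinates\<close>

lemma tpowD: "v \<in> tpow N n \<Longrightarrow> w \<notin> words N n \<Longrightarrow> v w = 0"
  by (simp add: tpow_def)

lemma tpow_length: "v \<in> tpow N n \<Longrightarrow> length w \<noteq> n \<Longrightarrow> v w = 0"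
  by (auto simp: tpow_def words_def)

lemma tpow_eqI:
  assumes "x \<in> tpow N n" "y \<in> tpow N n" "\<And>w. w \<in> words N n \<Longrightarrow> x w = y w"
  shows "x = y"
proof
  fix w show "x w = y w" using assms by (cases "w \<in> words N n") (auto simp: tpow_def)
qed

lemma tpow_zero [simp]: "0 \<in> tpow N n"
  by (simp add: tpow_def)

lemma tpow_add: "x \<in> tpow N n \<Longrightarrow> y \<in> tpow N n \<Longrightarrow> x + y \<in> tpow N n"
  by (simp add: tpow_def)

lemma tpow_diff: "x \<in> tpow N n \<Longrightarrow> y \<in> tpow N n \<Longrightarrow> x - y \<in> tpow N n"
  by (simp add: tpow_def)

lemma tpow_scale: "x \<in> tpow N n \<Longrightarrow> scale c x \<in> tpow N n"
  by (simp add: tpow_def scale_def)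

lemma tpow_sum: "(\<And>a. a \<in> A \<Longrightarrow> f a \<in> tpow N n) \<Longrightarrow> (\<Sum>a\<in>A. f a) \<in> tpow N n"
  by (simp add: tpow_def sum_fun_app)

lemma scale_sum: "scale c (\<Sum>a\<in>A. f a) = (\<Sum>a\<in>A. scale c (f a))"
  by (simp add: scale_def sum_fun_app sum_distrib_left fun_eq_iff)

lemma scale_scale: "scale c (scale d v) = scale (c * d) v"
  by (simp add: scale_def mult.assoc)

lemma scale_zero [simp]: "scale c 0 = 0" "scale 0 v = 0"
  by (simp_all add: scale_def fun_eq_iff)

lemma scale_one [simp]: "scale 1 v = v"
  by (simp add: scale_def)

lemma wbasis_tprod:
  "(wbasis u \<otimes>\<^sub>t v) w = (if length u \<le> length w \<and> take (length u) w = u then v (drop (length u) w) else 0)"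
proof -
  have "(wbasis u \<otimes>\<^sub>t v) w = (\<Sum>k\<le>length w. if k = length u then (if take k w = u then v (drop k w) else 0) else 0)"
    unfolding tprod_def wbasis_def by (intro sum.cong) auto
  then show ?thesis by simp
qed

lemma wbasis_single_tprod:
  "(wbasis [i] \<otimes>\<^sub>t v) w = (case w of [] \<Rightarrow> 0 | j # w' \<Rightarrow> if j = i then v w' else 0)"
  by (auto simp: wbasis_tprod split: list.split)

lemma wbasis_Cons_tprod: "wbasis (i # u) \<otimes>\<^sub>t v = wbasis [i] \<otimes>\<^sub>t (wbasis u \<otimes>\<^sub>t v)"
proof
  fix w show "(wbasis (i # u) \<otimes>\<^sub>t v) w = (wbasis [i] \<otimes>\<^sub>t (wbasis u \<otimes>\<^sub>t v)) w"
    by (cases w) (auto simp: wbasis_tprod)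
qed

lemma wbasis_Nil_tprod [simp]: "wbasis [] \<otimes>\<^sub>t v = v"
  by (rule ext) (simp add: wbasis_tprod)

lemma wbasis_tprod_wbasis: "wbasis u \<otimes>\<^sub>t wbasis w = wbasis (u @ w)"
proof
  fix x show "(wbasis u \<otimes>\<^sub>t wbasis w) x = wbasis (u @ w) x"
    unfolding wbasis_tprod by (auto simp: wbasis_def) (metis append_take_drop_id)
qed

text \<open>Since \<open>x\<close> is supported on words of length \<open>a\<close>, only the cut
  after \<open>a\<close> letters contributes to the sum in \<open>tprod\<close>.\<close>

lemma tprod_append: "x \<in> tpow N a \<Longrightarrow> length u = a \<Longrightarrow> (x \<otimes>\<^sub>t y) (u @ w) = x u * y w"
proof -
  assume x: "x \<in> tpow N a" and u: "length u = a"
  have "(x \<otimes>\<^sub>t y) (u @ w) = (\<Sum>k\<le>length (u @ w). if k = a then x u * y w else 0)"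
    unfolding tprod_def
  proof (intro sum.cong refl)
    fix k assume "k \<in> {..length (u @ w)}"
    then show "x (take k (u @ w)) * y (drop k (u @ w)) = (if k = a then x u * y w else 0)"
      using u tpow_length[OF x, of "take k (u @ w)"] by auto
  qed
  then show ?thesis using u by simp
qed

lemma tprod_short: "x \<in> tpow N a \<Longrightarrow> length w < a \<Longrightarrow> (x \<otimes>\<^sub>t y) w = 0"
  unfolding tprod_def by (intro sum.neutral) (auto simp: tpow_length)

lemma tpow_tprod: "x \<in> tpow N a \<Longrightarrow> y \<in> tpow N b \<Longrightarrow> x \<otimes>\<^sub>t y \<in> tpow N (a + b)"
proof -
  assume x: "x \<in> tpow N a" and y: "y \<in> tpow N b"
  have "(x \<otimes>\<^sub>t y) w = 0" if w: "w \<notin> words N (a + b)" for w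
  proof (cases "length w < a")
    case True then show ?thesis by (rule tprod_short[OF x])
  next
    case False
    then have l: "length (take a w) = a" by simp
    have "take a w \<notin> words N a \<or> drop a w \<notin> words N b"
      using w append_in_words[OF l, of "drop a w" N b] by auto
    then show ?thesis using tprod_append[OF x l, of y "drop a w"] x y by (auto simp: tpow_def)
  qed
  then show ?thesis by (simp add: tpow_def)
qed

lemma wbasis_tpow: "u \<in> words N n \<Longrightarrow> wbasis u \<in> tpow N n"
  by (auto simp: tpow_def wbasis_def)

lemma tprod_sum_left: "(\<Sum>a\<in>A. f a) \<otimes>\<^sub>t y = (\<Sum>a\<in>A. f a \<otimes>\<^sub>t y)"
  by (rule ext) (simp add: tprod_def sum_fun_app sum_distrib_right sum.swap[of _ A])

lemma tprod_sum_right: "y \<otimes>\<^sub>t (\<Sum>a\<in>A. f a) = (\<Sum>a\<in>A. y \<otimes>\<^sub>t f a)"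
  by (rule ext) (simp add: tprod_def sum_fun_app sum_distrib_left sum.swap[of _ A])

lemma tprod_scale_left: "scale c x \<otimes>\<^sub>t y = scale c (x \<otimes>\<^sub>t y)"
  by (rule ext) (simp add: tprod_def scale_def sum_distrib_left mult.assoc)

lemma tprod_scale_right: "x \<otimes>\<^sub>t scale c y = scale c (x \<otimes>\<^sub>t y)"
  by (rule ext) (simp add: tprod_def scale_def sum_distrib_left mult_ac)

lemma tpow_expand: "v \<in> tpow N n \<Longrightarrow> v = (\<Sum>w\<in>words N n. scale (v w) (wbasis w))"
proof
  fix x assume v: "v \<in> tpow N n"
  have "(\<Sum>w\<in>words N n. scale (v w) (wbasis w)) x = (\<Sum>w\<in>words N n. if x = w then v w else 0)"
    unfolding sum_fun_app by (intro sum.cong) (auto simp: scale_def wbasis_def)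
  then show "v x = (\<Sum>w\<in>words N n. scale (v w) (wbasis w)) x"
    using v by (simp add: tpow_def)
qed

lemma bra_wbasis: "u \<in> words N n \<Longrightarrow> bra N n \<xi> (wbasis u) = scale (cnj (\<xi> u)) (wbasis [])"
proof -
  assume u: "u \<in> words N n"
  have "tinner N n (wbasis u) \<xi> = (\<Sum>w\<in>words N n. if w = u then cnj (\<xi> w) else 0)"
    unfolding tinner_def wbasis_def by (intro sum.cong) auto
  with u show ?thesis by (simp add: bra_def)
qed

section \<open>Tensor products of operators in coordinates\<close>

lemma op_tensor_id_left:
  "op_tensor N a c id T v w = (if a \<le> length w \<and> take a w \<in> words N a
     then \<Sum>x\<in>words N c. v (take a w @ x) * T (wbasis x) (drop a w) else 0)"
proof -
  have "op_tensor N a c id T v w =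
    (\<Sum>u\<in>words N a. if u = take a w then (if a \<le> length w then \<Sum>x\<in>words N c. v (u @ x) * T (wbasis x) (drop a w) else 0) else 0)"
    unfolding op_tensor_def sum_fun_app
    by (intro sum.cong) (auto simp: scale_def wbasis_tprod words_def sum_fun_app intro!: sum.cong)
  then show ?thesis by (simp add: )
qed

text \<open>The operator on the first \<open>p\<close> legs has rank one, so every basis word
  contributes a multiple of \<open>x\<close>; what is left over is the partial inner product of
  \<open>v\<close> with \<xi>.\<close>

lemma op_tensor_ket_bra:
  assumes "v \<in> tpow N (p + r)"
  shows "op_tensor N p r (ket x \<circ> bra N p \<xi>) id v =
    x \<otimes>\<^sub>t (\<lambda>w. \<Sum>u\<in>words N p. cnj (\<xi> u) * v (u @ w))"
proof -
  have "(\<Sum>u\<in>words N p. \<Sum>w\<in>words N r. scale (v (u @ w)) (scale (cnj (\<xi> u)) x \<otimes>\<^sub>t wbasis w))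
    = x \<otimes>\<^sub>t (\<Sum>u\<in>words N p. scale (cnj (\<xi> u)) (\<Sum>w\<in>words N r. scale (v (u @ w)) (wbasis w)))"
    by (simp add: tprod_sum_right tprod_scale_right tprod_scale_left scale_sum scale_scale mult.commute)
  also have "(\<Sum>u\<in>words N p. scale (cnj (\<xi> u)) (\<Sum>w\<in>words N r. scale (v (u @ w)) (wbasis w)))
     = (\<lambda>w. \<Sum>u\<in>words N p. cnj (\<xi> u) * v (u @ w))"
  proof -
    have "(\<Sum>w\<in>words N r. scale (v (u @ w)) (wbasis w)) = (\<lambda>w. v (u @ w))" if "u \<in> words N p" for u
      using tpow_expand[of "\<lambda>w. v (u @ w)" N r] assms that
      by (auto simp: tpow_def append_in_words length_words)
    then show ?thesis by (auto simp: fun_eq_iff sum_fun_app scale_def)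
  qed
  finally have *: "(\<Sum>u\<in>words N p. \<Sum>w\<in>words N r. scale (v (u @ w)) (scale (cnj (\<xi> u)) x \<otimes>\<^sub>t wbasis w))
     = x \<otimes>\<^sub>t (\<lambda>w. \<Sum>u\<in>words N p. cnj (\<xi> u) * v (u @ w))" .
  have "ket x (scale c (wbasis [])) = scale c x" for c
    by (simp add: ket_def scale_def wbasis_def)
  then show ?thesis unfolding op_tensor_def using *
    by (simp add: bra_wbasis cong: sum.cong)
qed

lemma op_tensor_bra:
  assumes "v \<in> tpow N (p + r)"
  shows "op_tensor N p r (bra N p \<xi>) id v = (\<lambda>w. \<Sum>u\<in>words N p. cnj (\<xi> u) * v (u @ w))"
proof -
  \<comment> \<open>A bra is a rank-one map whose ket is the empty word, the unit vector of the
    degree 0 power.\<close>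
  have "bra N p \<xi> = ket (wbasis []) \<circ> bra N p \<xi>"
    by (simp add: fun_eq_iff ket_def bra_def scale_def wbasis_def)
  then show ?thesis using op_tensor_ket_bra[OF assms, of "wbasis []" \<xi>] by simp
qed

lemma op_tensor_ket:
  assumes "v \<in> tpow N r"
  shows "op_tensor N 0 r (ket x) id v = x \<otimes>\<^sub>t v"
proof -
  have "op_tensor N 0 r (ket x) id v = x \<otimes>\<^sub>t (\<Sum>w\<in>words N r. scale (v w) (wbasis w))"
    by (simp add: op_tensor_def ket_def wbasis_def[of "[]"] tprod_sum_right tprod_scale_right)
  then show ?thesis using tpow_expand[OF assms] by simp
qed

section \<open>The spaces H_n as trace-free tensors\<close>

lemma t1_apply: "t1 N [i, j] = (if i = j \<and> i < N then 1 else 0)"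
proof -
  have "t1 N [i, j] = (\<Sum>k<N. if k = i then (if i = j then 1 else 0) else 0)"
    unfolding t1_def sum_fun_app by (intro sum.cong) (auto simp: wbasis_tprod_wbasis wbasis_def[of "[_, _]"])
  then show ?thesis by auto
qed

lemma contract_t1:
  assumes "v \<in> tpow N (2 + r)"
  shows "op_tensor N 2 r (bra N 2 (t1 N)) id v = (\<lambda>w. \<Sum>i<N. v (i # i # w))"
proof -
  have "(\<Sum>u\<in>words N 2. cnj (t1 N u) * v (u @ w)) = (\<Sum>i<N. \<Sum>j<N. if j = i then v (i # i # w) else 0)" for w
    unfolding numeral_2_eq_2 sum_words_Suc
    by (intro sum.cong) (auto simp: t1_apply)
  then show ?thesis unfolding op_tensor_bra[OF assms] by simp
qed

lemma Hsp_iff: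
  "v \<in> Hsp N n \<longleftrightarrow> v \<in> tpow N n \<and>
     (\<forall>u w. length u + length w + 2 = n \<longrightarrow> (\<Sum>i<N. v (u @ i # i # w)) = 0)"
proof (cases "v \<in> tpow N n")
  case v: True
  \<comment> \<open>The value is computed at every word \<open>x\<close>, also one of the wrong
    length, because equality with 0 is tested pointwise.\<close>
  have eq: "op_tensor N l (n - l) id (op_tensor N 2 (n - l - 2) (bra N 2 (t1 N)) id) v x =
     (if l \<le> length x then \<Sum>i<N. v (take l x @ i # i # drop l x) else 0)" if l: "l + 2 \<le> n" for l x
  proof (cases "l \<le> length x \<and> take l x \<in> words N l")
    case True
    have "(\<Sum>y\<in>words N (n - l). v (take l x @ y) * op_tensor N 2 (n - l - 2) (bra N 2 (t1 N)) id (wbasis y) (drop l x))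
      = (\<Sum>y\<in>words N (n - l). v (take l x @ y) * (\<Sum>i<N. wbasis y (i # i # drop l x)))"
    proof (intro sum.cong refl)
      fix y assume "y \<in> words N (n - l)"
      moreover have "2 + (n - l - 2) = n - l" using l by simp
      ultimately have "wbasis y \<in> tpow N (2 + (n - l - 2))" by (simp only: wbasis_tpow)
      then show "v (take l x @ y) * op_tensor N 2 (n - l - 2) (bra N 2 (t1 N)) id (wbasis y) (drop l x)
        = v (take l x @ y) * (\<Sum>i<N. wbasis y (i # i # drop l x))"
        by (simp only: contract_t1)
    qed
    also have "\<dots> = (\<Sum>i<N. \<Sum>y\<in>words N (n - l). if y = i # i # drop l x then v (take l x @ y) else 0)"
      unfolding sum_distrib_left by (subst sum.swap) (auto simp: wbasis_def intro!: sum.cong)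
    also have "\<dots> = (\<Sum>i<N. v (take l x @ i # i # drop l x))"
    proof (intro sum.cong refl)
      fix i
      have "v (take l x @ i # i # drop l x) = 0" if "i # i # drop l x \<notin> words N (n - l)"
        using tpowD[OF v] that True append_in_words[of "take l x" l "i # i # drop l x" N "n - l"] l
        by auto
      then show "(\<Sum>y\<in>words N (n - l). if y = i # i # drop l x then v (take l x @ y) else 0)
         = v (take l x @ i # i # drop l x)" by auto
    qed
    finally show ?thesis using True by (simp add: op_tensor_id_left)
  next
    case False
    have "v (take l x @ i # i # drop l x) = 0" if "l \<le> length x" "take l x \<notin> words N l" for i
      using tpowD[OF v] that append_in_words[of "take l x" l "i # i # drop l x" N "n - l"] l
      by auto
    then show ?thesis using False by (auto simp add: op_tensor_id_left)
  qed
  have "v \<in> Hsp N n \<longleftrightarrow> (\<forall>l. l + 2 \<le> n \<longrightarrow> (\<forall>x. l \<le> length x \<longrightarrow> (\<Sum>i<N. v (take l x @ i # i # drop l x)) = 0))"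
  proof -
    have "v \<in> Hsp N n \<longleftrightarrow> (\<forall>l. l + 2 \<le> n \<longrightarrow> (\<forall>x.
      op_tensor N l (n - l) id (op_tensor N 2 (n - l - 2) (bra N 2 (t1 N)) id) v x = 0))"
      using v by (simp only: Hsp_def fun_eq_iff mem_Collect_eq zero_fun_def simp_thms)
    also have "\<dots> \<longleftrightarrow> (\<forall>l. l + 2 \<le> n \<longrightarrow> (\<forall>x. l \<le> length x \<longrightarrow> (\<Sum>i<N. v (take l x @ i # i # drop l x)) = 0))"
      by (intro arg_cong[where f = All] ext imp_cong refl) (simp only: eq, auto)
    finally show ?thesis .
  qed
  also have "\<dots> \<longleftrightarrow> (\<forall>u w. length u + length w + 2 = n \<longrightarrow> (\<Sum>i<N. v (u @ i # i # w)) = 0)"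
  proof (intro iffI allI impI)
    fix u w :: "nat list" assume "\<forall>l. l + 2 \<le> n \<longrightarrow> (\<forall>x. l \<le> length x \<longrightarrow> (\<Sum>i<N. v (take l x @ i # i # drop l x)) = 0)"
      and n: "length u + length w + 2 = n"
    then have "(\<Sum>i<N. v (take (length u) (u @ w) @ i # i # drop (length u) (u @ w))) = 0"
      by (metis add_le_mono1 le_add1 length_append)
    then show "(\<Sum>i<N. v (u @ i # i # w)) = 0" by simp
  next
    fix l and x :: "nat list" assume *: "\<forall>u w. length u + length w + 2 = n \<longrightarrow> (\<Sum>i<N. v (u @ i # i # w)) = 0"
      and l: "l + 2 \<le> n" "l \<le> length x"
    show "(\<Sum>i<N. v (take l x @ i # i # drop l x)) = 0"
    proof (cases "length x + 2 = n")
      case True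
      have "length (take l x) + length (drop l x) + 2 = n" using l True by simp
      with * show ?thesis by blast
    next
      case False
      then show ?thesis using l by (intro sum.neutral ballI tpow_length[OF v]) auto
    qed
  qed
  finally show ?thesis using v by simp
qed (simp add: Hsp_def)

lemma HspI:
  assumes "v \<in> tpow N n"
    and "\<And>u w. length u + length w + 2 = n \<Longrightarrow> (\<Sum>i<N. v (u @ i # i # w)) = 0"
  shows "v \<in> Hsp N n"
  using assms by (auto simp: Hsp_iff)

lemma Hsp_trace: "v \<in> Hsp N n \<Longrightarrow> length u + length w + 2 = n \<Longrightarrow> (\<Sum>i<N. v (u @ i # i # w)) = 0"
  by (simp add: Hsp_iff)

lemma Hsp_tpow: "v \<in> Hsp N n \<Longrightarrow> v \<in> tpow N n"
  by (simp add: Hsp_iff)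

lemma Hsp_zero [simp]: "0 \<in> Hsp N n"
  by (rule HspI) auto

lemma Hsp_add: "x \<in> Hsp N n \<Longrightarrow> y \<in> Hsp N n \<Longrightarrow> x + y \<in> Hsp N n"
  by (rule HspI) (auto simp: Hsp_tpow tpow_add sum.distrib Hsp_trace)

lemma Hsp_diff: "x \<in> Hsp N n \<Longrightarrow> y \<in> Hsp N n \<Longrightarrow> x - y \<in> Hsp N n"
  by (rule HspI) (auto simp: Hsp_tpow tpow_diff sum_subtractf Hsp_trace)

lemma Hsp_scale: "x \<in> Hsp N n \<Longrightarrow> scale c x \<in> Hsp N n"
  by (rule HspI) (auto simp: Hsp_tpow tpow_scale Hsp_trace, auto simp: scale_def Hsp_trace simp flip: sum_distrib_left)

lemma Hsp_sum: "(\<And>a. a \<in> A \<Longrightarrow> f a \<in> Hsp N n) \<Longrightarrow> (\<Sum>a\<in>A. f a) \<in> Hsp N n"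
  by (induction A rule: infinite_finite_induct) (auto intro: Hsp_add)

section \<open>Contraction of the first legs\<close>

text \<open>For \<open>u = [u\<^sub>1, \<dots>, u\<^sub>p]\<close> this is the composite of the contractions of the first leg with
  \<open>e\<^bsub>u\<^sub>p\<^esub>\<close>, \dots, \<open>e\<^bsub>u\<^sub>1\<^esub>\<close>, in this order; hence the reversal.\<close>

definition contract :: "nat list \<Rightarrow> tens \<Rightarrow> tens" where
  "contract u v = (\<lambda>w. v (rev u @ w))"

lemma contract_Nil [simp]: "contract [] v = v"
  by (simp add: contract_def)

lemma contract_Cons: "contract (i # u) v = contract [i] (contract u v)"
  by (simp add: contract_def)

lemma contract_single: "contract [i] v w = v (i # w)"
  by (simp add: contract_def)

lemma contract_add: "contract u (x + y) = contract u x + contract u y"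
  by (simp add: contract_def fun_eq_iff)

lemma contract_sum: "contract u (\<Sum>a\<in>A. f a) = (\<Sum>a\<in>A. contract u (f a))"
  by (simp add: contract_def fun_eq_iff sum_fun_app)

lemma contract_scale: "contract u (scale c v) = scale c (contract u v)"
  by (simp add: contract_def scale_def)

lemma tpow_contract: "v \<in> tpow N (length u + n) \<Longrightarrow> contract u v \<in> tpow N n"
  by (auto simp: tpow_def contract_def append_in_words)

lemma tpow_contract_single: "v \<in> tpow N (Suc n) \<Longrightarrow> contract [i] v \<in> tpow N n"
  using tpow_contract[of v N "[i]" n] by simp

lemma Hsp_contract: "v \<in> Hsp N (length u + n) \<Longrightarrow> contract u v \<in> Hsp N n"
proof (rule HspI)
  assume v: "v \<in> Hsp N (length u + n)"
  show "contract u v \<in> tpow N n" using v by (simp add: Hsp_tpow tpow_contract)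
  fix x w :: "nat list" assume "length x + length w + 2 = n"
  then show "(\<Sum>i<N. contract u v (x @ i # i # w)) = 0"
    using Hsp_trace[OF v, of "rev u @ x" w] by (simp add: contract_def)
qed

lemma Hsp_contract_single: "v \<in> Hsp N (Suc n) \<Longrightarrow> contract [i] v \<in> Hsp N n"
  using Hsp_contract[of v N "[i]" n] by simp

lemma contract_wbasis_tprod: "contract [i] (wbasis [j] \<otimes>\<^sub>t v) = (if i = j then v else 0)"
  by (simp add: fun_eq_iff contract_single wbasis_single_tprod)

text \<open>Splitting off the first leg; this drives the induction on the degree in
  \<open>is_proj_exists\<close>.\<close>

lemma tpow_split:
  assumes "v \<in> tpow N (Suc n)"
  shows "v = (\<Sum>i<N. wbasis [i] \<otimes>\<^sub>t contract [i] v)"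
proof
  fix w show "v w = (\<Sum>i<N. wbasis [i] \<otimes>\<^sub>t contract [i] v) w"
  proof (cases w)
    case Nil then show ?thesis using assms by (simp add: tpow_def words_def sum_fun_app contract_single wbasis_single_tprod)
  next
    case (Cons j w')
    then show ?thesis using assms by (auto simp: sum_fun_app contract_single wbasis_single_tprod tpow_def)
  qed
qed

lemma tpow_Suc_iff:
  "v \<in> tpow N (Suc n) \<longleftrightarrow> v [] = 0 \<and> (\<forall>i. contract [i] v \<in> tpow N n \<and> (i \<ge> N \<longrightarrow> contract [i] v = 0))"
proof
  assume v: "v \<in> tpow N (Suc n)"
  then have "contract [i] v \<in> tpow N n" for i by (rule tpow_contract_single)
  moreover have "v [] = 0" using v by (simp add: tpow_def words_def)
  moreover have "contract [i] v = 0" if "i \<ge> N" for i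
    using v that by (simp add: fun_eq_iff contract_single tpow_def)
  ultimately show "v [] = 0 \<and> (\<forall>i. contract [i] v \<in> tpow N n \<and> (i \<ge> N \<longrightarrow> contract [i] v = 0))"
    by blast
next
  assume v: "v [] = 0 \<and> (\<forall>i. contract [i] v \<in> tpow N n \<and> (i \<ge> N \<longrightarrow> contract [i] v = 0))"
  have "v w = 0" if "w \<notin> words N (Suc n)" for w
  proof (cases w)
    case (Cons i w')
    have "contract [i] v w' = 0"
      using v that Cons tpowD[of "contract [i] v" N n w'] by (cases "i < N") auto
    then show ?thesis using Cons by (simp add: contract_single)
  qed (use v in simp)
  then show "v \<in> tpow N (Suc n)" by (simp add: tpow_def)
qed

section \<open>Inner products and orthogonal projections onto H_n\<close>

lemma tinner_add: "tinner N n (x + y) k = tinner N n x k + tinner N n y k"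
  by (simp add: tinner_def sum.distrib distrib_right)

lemma tinner_diff: "tinner N n (x - y) k = tinner N n x k - tinner N n y k"
  by (simp add: tinner_def sum_subtractf left_diff_distrib)

lemma tinner_scale: "tinner N n (scale c x) k = c * tinner N n x k"
  by (simp add: tinner_def scale_def sum_distrib_left mult.assoc)

lemma tinner_zero [simp]: "tinner N n 0 k = 0"
  by (simp add: tinner_def)

lemma tinner_sum: "tinner N n (\<Sum>a\<in>A. f a) k = (\<Sum>a\<in>A. tinner N n (f a) k)"
  unfolding tinner_def sum_fun_app sum_distrib_right by (rule sum.swap)

lemma tinner_Suc: "tinner N (Suc n) x y = (\<Sum>i<N. tinner N n (contract [i] x) (contract [i] y))"
  by (simp add: tinner_def sum_words_Suc contract_single)

text \<open>Creation and contraction are adjoint, which carries orthogonality to H_n over to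
  H_(n+1).\<close>

lemma tinner_wbasis_tprod:
  assumes "i < N"
  shows "tinner N (Suc n) (wbasis [i] \<otimes>\<^sub>t v) k = tinner N n v (contract [i] k)"
proof -
  have "tinner N (Suc n) (wbasis [i] \<otimes>\<^sub>t v) k =
    (\<Sum>j<N. if j = i then tinner N n v (contract [i] k) else 0)"
    unfolding tinner_Suc contract_wbasis_tprod by (intro sum.cong) auto
  then show ?thesis using assms by simp
qed

lemma tinner_self_eq_0:
  assumes "v \<in> tpow N n" "tinner N n v v = 0"
  shows "v = 0"
proof -
  have "of_real (\<Sum>w\<in>words N n. (cmod (v w))\<^sup>2) = (0::complex)"
    using assms(2) by (simp add: tinner_def complex_mult_cnj cmod_power2)
  then have "(\<Sum>w\<in>words N n. (cmod (v w))\<^sup>2) = 0"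
    using of_real_eq_0_iff by blast
  then have "\<forall>w\<in>words N n. v w = 0"
    by (subst (asm) sum_nonneg_eq_0_iff) auto
  then show ?thesis using assms(1) by (auto intro: tpow_eqI)
qed

text \<open>The property under the description operator of \<open>JW\<close>, kept as a relation:
  linearity and explicit formulas can be used before existence of the projection is known.\<close>

definition is_proj :: "nat \<Rightarrow> nat \<Rightarrow> tens \<Rightarrow> tens \<Rightarrow> bool" where
  "is_proj N n v h \<longleftrightarrow> h \<in> Hsp N n \<and> (\<forall>k\<in>Hsp N n. tinner N n (v - h) k = 0)"

text \<open>The difference of two candidates lies in H_n and is orthogonal to H_n, hence to
  itself.\<close>

lemma is_proj_unique: "is_proj N n v h \<Longrightarrow> is_proj N n v h' \<Longrightarrow> h = h'"
proof -
  assume h: "is_proj N n v h" "is_proj N n v h'"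
  then have d: "h - h' \<in> Hsp N n" by (simp add: is_proj_def Hsp_diff)
  have "tinner N n ((v - h') - (v - h)) (h - h') = 0"
    using h d by (simp only: tinner_diff[of _ _ "v - h'"] is_proj_def) simp
  then have "h - h' = 0" using d tinner_self_eq_0 Hsp_tpow by fastforce
  then show ?thesis by simp
qed

lemma JW_eqI: "is_proj N n v h \<Longrightarrow> JW N n v = h"
  unfolding JW_def is_proj_def[symmetric] by (rule the_equality) (auto intro: is_proj_unique)

lemma is_proj_self: "v \<in> Hsp N n \<Longrightarrow> is_proj N n v v"
  by (simp add: is_proj_def)

lemma is_proj_add: "is_proj N n x g \<Longrightarrow> is_proj N n y h \<Longrightarrow> is_proj N n (x + y) (g + h)"
  by (auto simp: is_proj_def Hsp_add tinner_add tinner_diff)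

lemma is_proj_scale: "is_proj N n x g \<Longrightarrow> is_proj N n (scale c x) (scale c g)"
  by (auto simp: is_proj_def Hsp_scale tinner_scale tinner_diff)

lemma is_proj_zero: "is_proj N n 0 0"
  by (simp add: is_proj_self)

lemma is_proj_sum:
  "(\<And>a. a \<in> A \<Longrightarrow> is_proj N n (f a) (g a)) \<Longrightarrow> is_proj N n (\<Sum>a\<in>A. f a) (\<Sum>a\<in>A. g a)"
  by (induction A rule: infinite_finite_induct) (auto intro: is_proj_add is_proj_zero)

text \<open>Contracting an element of H_(n+1) gives an element of H_n, to which \<open>v - h\<close>
  is orthogonal. So \<open>v\<close> may be projected before a basis vector is put in front of
  it.\<close>

lemma is_proj_wbasis_tprod:
  assumes "is_proj N n v h" "is_proj N (Suc n) (wbasis [i] \<otimes>\<^sub>t h) g" "i < N"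
  shows "is_proj N (Suc n) (wbasis [i] \<otimes>\<^sub>t v) g"
  using assms
  by (auto simp: is_proj_def tinner_diff tinner_wbasis_tprod Hsp_contract_single)

section \<open>Cups and their traces\<close>

text \<open>This inserts \<open>t1 N\<close> after the first \<open>k\<close> legs of
  \<open>v\<close>. The recursion goes through the first leg, so that \<open>contract\<close>
  commutes with it by mere unfolding.\<close>

primrec cup :: "nat \<Rightarrow> nat \<Rightarrow> tens \<Rightarrow> tens" where
  "cup N 0 v = (\<lambda>w. case w of i # j # w' \<Rightarrow> if i = j \<and> i < N then v w' else 0 | _ \<Rightarrow> 0)"
| "cup N (Suc k) v = (\<lambda>w. case w of [] \<Rightarrow> 0 | i # w' \<Rightarrow> cup N k (contract [i] v) w')"

lemma contract_cup_0: "i < N \<Longrightarrow> contract [i] (cup N 0 v) = wbasis [i] \<otimes>\<^sub>t v"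
  by (auto simp: fun_eq_iff contract_single wbasis_single_tprod split: list.split)

lemma contract_cup_Suc: "contract [i] (cup N (Suc k) v) = cup N k (contract [i] v)"
  by (simp add: fun_eq_iff contract_single)

lemma cup_zero [simp]: "cup N k 0 = 0"
proof (induction k)
  case (Suc k)
  have *: "contract [i] 0 = 0" for i by (simp add: fun_eq_iff contract_single)
  show ?case
  proof
    fix w show "cup N (Suc k) 0 w = 0 w"
      by (cases w) (simp_all add: * Suc)
  qed
qed (auto simp: fun_eq_iff split: list.split)

lemma cup_append: "length u = k \<Longrightarrow> cup N k v (u @ i # j # w) = (if i = j \<and> i < N then v (u @ w) else 0)"
  by (induction u arbitrary: k v) (auto simp: contract_single)

lemma tpow_cup: "v \<in> tpow N n \<Longrightarrow> k \<le> n \<Longrightarrow> cup N k v \<in> tpow N (Suc (Suc n))"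
proof (induction k arbitrary: v n)
  case 0
  then show ?case by (auto simp: tpow_def split: list.split)
next
  case (Suc k)
  then obtain m where n: "n = Suc m" by (cases n) auto
  have "contract [i] v \<in> tpow N m \<and> (i \<ge> N \<longrightarrow> contract [i] v = 0)" for i
    using Suc.prems n tpow_Suc_iff by blast
  then show ?case
    using Suc n by (subst tpow_Suc_iff) (auto simp: contract_cup_Suc simp del: cup.simps(2), simp)
qed

text \<open>Inserting \<open>t1 N\<close> is adjoint to the trace over the two inserted legs, and
  this trace vanishes on H_(n+2). The induction strips the legs to the left of the cup.\<close>

lemma tinner_cup: "h \<in> Hsp N (Suc (Suc n)) \<Longrightarrow> k \<le> n \<Longrightarrow> tinner N (Suc (Suc n)) (cup N k v) h = 0"
proof (induction k arbitrary: v n h)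
  case 0
  have "tinner N (Suc (Suc n)) (cup N 0 v) h =
      (\<Sum>i<N. \<Sum>j<N. if j = i then \<Sum>w\<in>words N n. v w * cnj (h (i # i # w)) else 0)"
    unfolding tinner_def sum_words_Suc by (intro sum.cong) auto
  also have "\<dots> = (\<Sum>i<N. \<Sum>w\<in>words N n. v w * cnj (h (i # i # w)))"
    by simp
  also have "\<dots> = (\<Sum>w\<in>words N n. v w * cnj (\<Sum>i<N. h (i # i # w)))"
    by (subst sum.swap) (simp add: sum_distrib_left)
  also have "\<dots> = 0"
    using Hsp_trace[OF 0(1), of "[]"] by (intro sum.neutral) (auto simp: length_words)
  finally show ?case .
next
  case (Suc k)
  then obtain m where n: "n = Suc m" by (cases n) auto
  show ?case unfolding tinner_Suc[of N "Suc n"] contract_cup_Suc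
    using Suc.prems n by (intro sum.neutral ballI) (auto intro: Suc.IH Hsp_contract_single)
qed

lemma is_proj_cup:
  assumes "k \<le> n"
  shows "is_proj N (Suc (Suc n)) (cup N k v) 0"
  using tinner_cup assms by (auto simp: is_proj_def)

lemma obtain_two_letters:
  assumes "k + 2 \<le> length w"
  obtains w1 a b w2 where "w = w1 @ a # b # w2" "length w1 = k"
proof -
  have "w = take k w @ w ! k # w ! Suc k # drop (Suc (Suc k)) w"
    using assms by (simp add: Cons_nth_drop_Suc)
  moreover have "length (take k w) = k" using assms by simp
  ultimately show ?thesis using that by blast
qed

text \<open>The Temperley-Lieb relations. A trace on the cup itself closes a loop and gives
  \<open>N\<close>; a trace sharing one leg with the cup straightens a zigzag and gives
  \<open>v\<close>; otherwise cup and trace involve disjoint legs, and the trace falls on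
  \<open>v\<close>, where it vanishes.\<close>

lemma trace_cup:
  assumes v: "v \<in> Hsp N n" and k: "k \<le> n" and len: "length u + length w = n"
  shows "(\<Sum>i<N. cup N k v (u @ i # i # w)) =
    (if k = length u then of_nat N else if k = Suc (length u) \<or> Suc k = length u then 1 else 0) * v (u @ w)"
proof -
  consider "k = length u" | "k = Suc (length u)" | "Suc k = length u" | "length u + 2 \<le> k" | "k + 2 \<le> length u"
    by linarith
  then show ?thesis
  proof cases
    case 1
    then show ?thesis by (simp add: cup_append)
  next
    case 2
    then obtain b w' where w: "w = b # w'" using k len by (cases w) auto
    have "cup N k v (u @ i # i # w) = (if i = b then (if b < N then v (u @ w) else 0) else 0)" for i
      using cup_append[of "u @ [i]" k N v i b w'] 2 w by simp
    \<comment> \<open>If \<open>b\<close> is no admissible letter, no index of the sum equals it,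
      and the claimed value must vanish too.\<close>
    moreover have "v (u @ w) = 0" if "\<not> b < N"
      using tpowD[OF Hsp_tpow[OF v], of "u @ w"] w that by (simp add: words_def)
    ultimately show ?thesis using 2 by auto
  next
    case 3
    then obtain a u' where u: "u = u' @ [a]" by (cases u rule: rev_cases) auto
    have "cup N k v (u @ i # i # w) = (if i = a then (if a < N then v (u @ w) else 0) else 0)" for i
      using cup_append[of "u'" k N v a i "i # w"] 3 u by simp
    moreover have "v (u @ w) = 0" if "\<not> a < N"
      using tpowD[OF Hsp_tpow[OF v], of "u @ w"] u that by (simp add: words_def)
    ultimately show ?thesis using 3 by auto
  next
    case 4
    have "(k - length u - 2) + 2 \<le> length w" using 4 k len by simp
    then obtain w1 a b w2 where w: "w = w1 @ a # b # w2" and l: "length w1 = k - length u - 2"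
      by (rule obtain_two_letters)
    have "cup N k v (u @ i # i # w) = (if a = b \<and> a < N then v (u @ i # i # (w1 @ w2)) else 0)" for i
      using cup_append[of "u @ i # i # w1" k N v a b w2] w l 4 by simp
    moreover have "(\<Sum>i<N. v (u @ i # i # (w1 @ w2))) = 0"
      using len w by (intro Hsp_trace[OF v]) simp
    ultimately show ?thesis using 4 by (cases "a = b \<and> a < N") simp_all
  next
    case 5
    then obtain u1 a b u2 where u: "u = u1 @ a # b # u2" and l: "length u1 = k"
      by (rule obtain_two_letters)
    have "cup N k v (u @ i # i # w) = (if a = b \<and> a < N then v ((u1 @ u2) @ i # i # w) else 0)" for i
      using cup_append[of u1 k N v a b "u2 @ i # i # w"] u l by simp
    moreover have "(\<Sum>i<N. v ((u1 @ u2) @ i # i # w)) = 0"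
      using len u by (intro Hsp_trace[OF v]) simp
    ultimately show ?thesis using 5 by (cases "a = b \<and> a < N") simp_all
  qed
qed

section \<open>Quantum integers and the coefficients of the Wenzl recursion\<close>

text \<open>The quantum integers [k] with [2] = N; for positive k, [k] is the Chebyshev polynomial
  of the second kind of degree k - 1 at N / 2.\<close>

fun qn :: "nat \<Rightarrow> nat \<Rightarrow> real" where
  "qn N 0 = 0"
| "qn N (Suc 0) = 1"
| "qn N (Suc (Suc k)) = real N * qn N (Suc k) - qn N k"

text \<open>For N \<ge> 2 the recursion makes the increments nondecreasing, so the first increment 1
  persists. Nonnegativity must be carried along in the induction.\<close>

lemma qn_mono_step:
  assumes "N \<ge> 2"
  shows "0 \<le> qn N k \<and> qn N k + 1 \<le> qn N (Suc k)"
proof (induction k)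
  case (Suc k)
  have "2 * qn N (Suc k) \<le> real N * qn N (Suc k)"
    using assms Suc by (intro mult_right_mono) auto
  then have "qn N (Suc k) + 1 \<le> real N * qn N (Suc k) - qn N k" using Suc by linarith
  then show ?case using Suc by simp
qed simp

lemma qn_pos: "N \<ge> 2 \<Longrightarrow> 0 < k \<Longrightarrow> 0 < qn N k"
  using qn_mono_step[of N "k - 1"] by simp

lemma qn_nonneg: "N \<ge> 2 \<Longrightarrow> 0 \<le> qn N k"
  using qn_mono_step by blast

lemma qn_Suc_le: "N \<ge> 2 \<Longrightarrow> 0 < k \<Longrightarrow> qn N (Suc k) \<le> real N * qn N k"
  by (cases k) (auto simp: qn_nonneg)

text \<open>The coefficient of the cup at position \<open>k\<close> in the projection of a created
  vector over H_m. It vanishes at \<open>k = m\<close> because [0] = 0, and at \<open>k = 0\<close>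
  it is the swap factor -[m]/[m+1].\<close>

definition jw_coeff :: "nat \<Rightarrow> nat \<Rightarrow> nat \<Rightarrow> complex" where
  "jw_coeff N m k = of_real ((-1) ^ Suc k * qn N (m - k) / qn N (Suc m))"

text \<open>The condition for the trace over the first two legs to vanish: the loop from cup 0 and
  the zigzag from cup 1 cancel the contribution 1 of the created vector.\<close>

lemma jw_coeff_0: "N \<ge> 2 \<Longrightarrow> 0 < m \<Longrightarrow> of_nat N * jw_coeff N m 0 + jw_coeff N m 1 = -1"
proof -
  assume N: "N \<ge> 2" and m: "0 < m"
  then obtain l where l: "m = Suc l" by (cases m) auto
  have "qn N (Suc m) > 0" using N by (simp add: qn_pos)
  then have "real N * (- qn N m / qn N (Suc m)) + qn N (m - 1) / qn N (Suc m) = -1"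
    unfolding l by (simp add: field_simps del: qn.simps) (simp add: algebra_simps)
  then have "complex_of_real (real N * (- qn N m / qn N (Suc m)) + qn N (m - 1) / qn N (Suc m)) = -1"
    by (metis of_real_1 of_real_minus)
  then show ?thesis by (simp add: jw_coeff_def)
qed

text \<open>The condition at all later pairs of legs; up to sign and denominator it is the recursion
  of the quantum integers.\<close>

lemma jw_coeff_rec:
  assumes "Suc k < m"
  shows "jw_coeff N m k + of_nat N * jw_coeff N m (Suc k) + jw_coeff N m (Suc (Suc k)) = 0"
proof -
  obtain l where l: "m - k = Suc (Suc l)" using assms by (metis Suc_diff_Suc Suc_lessD)
  then have "m - Suc k = Suc l" "m - Suc (Suc k) = l" by auto
  with l have "(-1) ^ Suc k * qn N (m - k) / qn N (Suc m)
      + real N * ((-1) ^ Suc (Suc k) * qn N (m - Suc k) / qn N (Suc m))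
      + (-1) ^ Suc (Suc (Suc k)) * qn N (m - Suc (Suc k)) / qn N (Suc m) = 0"
    by (simp add: field_simps flip: add_divide_distrib diff_divide_distrib)
  then have "complex_of_real ((-1) ^ Suc k * qn N (m - k) / qn N (Suc m)
      + real N * ((-1) ^ Suc (Suc k) * qn N (m - Suc k) / qn N (Suc m))
      + (-1) ^ Suc (Suc (Suc k)) * qn N (m - Suc (Suc k)) / qn N (Suc m)) = 0"
    by simp
  then show ?thesis unfolding jw_coeff_def of_real_add of_real_mult of_real_of_nat_eq .
qed

text \<open>Only the positions next to \<open>l\<close> contribute. With \<open>c m = 0\<close> the
  last row, where \<open>Suc l = m\<close> is out of range, looks like the others.\<close>

lemma sum_tridiagonal:
  fixes c :: "nat \<Rightarrow> complex"
  assumes "l < m" "c m = 0"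
  shows "(\<Sum>k<m. c k * (if k = l then a else if k = Suc l \<or> Suc k = l then 1 else 0)) =
    (if l = 0 then 0 else c (l - 1)) + a * c l + c (Suc l)"
proof -
  have "(\<Sum>k<m. c k * (if k = l then a else if k = Suc l \<or> Suc k = l then 1 else 0)) =
    (\<Sum>k<m. (if k = l then a * c l else 0) + (if k = Suc l then c (Suc l) else 0)
       + (if k = l - 1 then if l = 0 then 0 else c (l - 1) else 0))"
    by (intro sum.cong) auto
  also have "\<dots> = a * c l + (if Suc l < m then c (Suc l) else 0) + (if l = 0 then 0 else c (l - 1))"
    unfolding sum.distrib using assms by auto
  also have "(if Suc l < m then c (Suc l) else 0) = c (Suc l)"
    using assms by (metis Suc_lessI)
  finally show ?thesis by simp
qed

section \<open>Projection of a created vector, and existence of P_n\<close>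

text \<open>This is the one-sided form of Wenzl's recursion: the coefficients are forced by the requirement that
  all contractions of neighbouring legs vanish, since the cups are orthogonal to \<open>H\<^sub>m\<^sub>+\<^sub>1\<close>.\<close>

lemma is_proj_create:
  assumes N: "N \<ge> 2" and v: "v \<in> Hsp N m" and j: "j < N"
  shows "is_proj N (Suc m) (wbasis [j] \<otimes>\<^sub>t v)
    (wbasis [j] \<otimes>\<^sub>t v + (\<Sum>k<m. scale (jw_coeff N m k) (cup N k (contract [j] v))))"
    (is "is_proj N _ ?x (?x + ?s)")
proof -
  have x: "?x \<in> tpow N (Suc m)"
    using tpow_tprod[OF wbasis_tpow[of "[j]" N 1] Hsp_tpow[OF v]] j by (simp add: words_def)
  have cup: "cup N k (contract [j] v) \<in> tpow N (Suc m)" "is_proj N (Suc m) (cup N k (contract [j] v)) 0"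
    if k: "k < m" for k
  proof -
    obtain l where "m = Suc l" using k by (cases m) auto
    then show "cup N k (contract [j] v) \<in> tpow N (Suc m)" "is_proj N (Suc m) (cup N k (contract [j] v)) 0"
      using k v by (auto simp: tpow_cup is_proj_cup Hsp_contract_single Hsp_tpow)
  qed
  have trace: "(\<Sum>i<N. (?x + ?s) (u @ i # i # w)) = 0" if len: "length u + length w + 2 = Suc m" for u w
  proof -
    obtain l where l: "m = Suc l" using len by (cases m) auto
    define y where "y = contract [j] v"
    have y: "y \<in> Hsp N l" unfolding y_def using v l by (simp add: Hsp_contract_single)
    have "(\<Sum>i<N. ?s (u @ i # i # w)) = (\<Sum>k<m. jw_coeff N m k * (\<Sum>i<N. cup N k y (u @ i # i # w)))"
      unfolding y_def sum_fun_app scale_def sum_distrib_left by (rule sum.swap)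
    also have "\<dots> = (\<Sum>k<m. jw_coeff N m k * (if k = length u then of_nat N
        else if k = Suc (length u) \<or> Suc k = length u then 1 else 0)) * y (u @ w)"
      unfolding sum_distrib_right mult.assoc using len l by (intro sum.cong refl) (simp add: trace_cup[OF y])
    also have "\<dots> = ((if length u = 0 then 0 else jw_coeff N m (length u - 1)) +
        of_nat N * jw_coeff N m (length u) + jw_coeff N m (Suc (length u))) * y (u @ w)"
      using len by (subst sum_tridiagonal) (auto simp: jw_coeff_def)
    also have "\<dots> = - (\<Sum>i<N. ?x (u @ i # i # w))"
    \<comment> \<open>Over the first two legs the created vector has trace \<open>y\<close>,
      cancelled through \<open>jw_coeff_0\<close>. Further to the right the trace falls inside
      \<open>v\<close> and is 0, so the coefficients must cancel among themselves by
      \<open>jw_coeff_rec\<close>.\<close>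
    proof (cases u)
      case Nil
      have "(\<Sum>i<N. ?x (i # i # w)) = y w"
        using j by (simp add: wbasis_single_tprod y_def contract_single)
      then show ?thesis using Nil jw_coeff_0[OF N, of m] l by simp
    next
      case (Cons a u')
      have "(\<Sum>i<N. v (u' @ i # i # w)) = 0"
        using Cons len by (intro Hsp_trace[OF v]) simp
      then have "(\<Sum>i<N. ?x (u @ i # i # w)) = 0"
        using Cons by (cases "a = j") (simp_all add: wbasis_single_tprod)
      then show ?thesis using jw_coeff_rec[of "length u'" m N] Cons len by simp
    qed
    finally show ?thesis by (simp add: sum.distrib)
  qed
  have "?x + ?s \<in> Hsp N (Suc m)"
    using x cup(1) trace by (intro HspI) (auto intro!: tpow_add tpow_sum tpow_scale)
  moreover have "tinner N (Suc m) ?s h = 0" if "h \<in> Hsp N (Suc m)" for h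
    using cup(2) that by (simp add: is_proj_def tinner_sum tinner_scale)
  ultimately show ?thesis by (simp only: is_proj_def tinner_add tinner_diff) simp
qed

text \<open>Induction on the degree: split off the first leg, project the remaining factor, and
  apply the explicit formula of \<open>is_proj_create\<close>. This makes the description in
  \<open>JW\<close> well defined.\<close>

lemma is_proj_exists:
  assumes "N \<ge> 2" "v \<in> tpow N n"
  shows "\<exists>h. is_proj N n v h"
  using assms(2)
proof (induction n arbitrary: v)
  case 0
  then have "v \<in> Hsp N 0" by (intro HspI) auto
  then show ?case using is_proj_self by blast
next
  case (Suc n)
  have "\<exists>g. is_proj N (Suc n) (wbasis [i] \<otimes>\<^sub>t contract [i] v) g" if i: "i < N" for i
  proof -
    obtain h where h: "is_proj N n (contract [i] v) h"
      using Suc tpow_contract_single by blast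
    then have "h \<in> Hsp N n" by (simp add: is_proj_def)
    with is_proj_create[OF assms(1) _ i] is_proj_wbasis_tprod[OF h _ i] show ?thesis by blast
  qed
  then obtain g where "\<And>i. i < N \<Longrightarrow> is_proj N (Suc n) (wbasis [i] \<otimes>\<^sub>t contract [i] v) (g i)"
    by metis
  then have "is_proj N (Suc n) (\<Sum>i<N. wbasis [i] \<otimes>\<^sub>t contract [i] v) (\<Sum>i<N. g i)"
    by (intro is_proj_sum) simp
  then show ?case using tpow_split[OF Suc.prems] by auto
qed

lemma JW_is_proj: "N \<ge> 2 \<Longrightarrow> v \<in> tpow N n \<Longrightarrow> is_proj N n v (JW N n v)"
  using is_proj_exists JW_eqI by blast

lemma JW_Hsp: "N \<ge> 2 \<Longrightarrow> v \<in> tpow N n \<Longrightarrow> JW N n v \<in> Hsp N n"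
  using JW_is_proj is_proj_def by blast

lemma JW_Hsp_eq: "v \<in> Hsp N n \<Longrightarrow> JW N n v = v"
  by (rule JW_eqI) (rule is_proj_self)

lemma JW_sum:
  assumes "N \<ge> 2" "\<And>a. a \<in> A \<Longrightarrow> f a \<in> tpow N n"
  shows "JW N n (\<Sum>a\<in>A. f a) = (\<Sum>a\<in>A. JW N n (f a))"
  using assms by (intro JW_eqI is_proj_sum JW_is_proj)

lemma JW_scale: "N \<ge> 2 \<Longrightarrow> v \<in> tpow N n \<Longrightarrow> JW N n (scale c v) = scale c (JW N n v)"
  by (intro JW_eqI is_proj_scale JW_is_proj)

lemma tpow_wbasis_tprod: "i < N \<Longrightarrow> v \<in> tpow N n \<Longrightarrow> wbasis [i] \<otimes>\<^sub>t v \<in> tpow N (Suc n)"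
  using tpow_tprod[OF wbasis_tpow[of "[i]" N 1]] by (simp add: words_def)

lemma JW_wbasis_tprod:
  assumes "N \<ge> 2" "i < N" "v \<in> tpow N n"
  shows "JW N (Suc n) (wbasis [i] \<otimes>\<^sub>t v) = JW N (Suc n) (wbasis [i] \<otimes>\<^sub>t JW N n v)"
proof (rule JW_eqI)
  have "JW N n v \<in> tpow N n" using assms by (simp add: JW_Hsp Hsp_tpow)
  then have "is_proj N (Suc n) (wbasis [i] \<otimes>\<^sub>t JW N n v) (JW N (Suc n) (wbasis [i] \<otimes>\<^sub>t JW N n v))"
    using assms by (intro JW_is_proj tpow_wbasis_tprod)
  then show "is_proj N (Suc n) (wbasis [i] \<otimes>\<^sub>t v) (JW N (Suc n) (wbasis [i] \<otimes>\<^sub>t JW N n v))"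
    using is_proj_wbasis_tprod[OF JW_is_proj[OF assms(1,3)]] assms(2) by blast
qed

section \<open>Moving contractions through creations\<close>

text \<open>Term by term in the explicit projection: the created vector gives the diagonal term, cup
  0 turns into a creation after a contraction, and every other cup moves one place to the
  left.\<close>

lemma contract_JW_create:
  assumes N: "N \<ge> 2" and v: "v \<in> Hsp N (Suc l)" and "i < N" "j < N"
  shows "contract [i] (JW N (Suc (Suc l)) (wbasis [j] \<otimes>\<^sub>t v)) = (if i = j then v else 0) +
    (scale (jw_coeff N (Suc l) 0) (wbasis [i] \<otimes>\<^sub>t contract [j] v) +
     (\<Sum>k<l. scale (jw_coeff N (Suc l) (Suc k)) (cup N k (contract [i] (contract [j] v)))))"
  unfolding JW_eqI[OF is_proj_create[OF N v \<open>j < N\<close>]] sum.lessThan_Suc_shift contract_add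
    contract_sum contract_scale contract_cup_Suc contract_cup_0[OF \<open>i < N\<close>] contract_wbasis_tprod ..

text \<open>The diagonal terms cancel because \<open>z\<close> has trace 0. The left side already
  lies in H_(l+1), so it may be projected there; this kills the remaining cups and turns the term
  from cup 0 into a creation.\<close>

lemma swap_contract_create:
  assumes N: "N \<ge> 2" and v: "v \<in> Hsp N (Suc l)" and z: "(\<Sum>i<N. z i i) = 0"
  shows "(\<Sum>i<N. \<Sum>j<N. scale (z i j) (contract [i] (JW N (Suc (Suc l)) (wbasis [j] \<otimes>\<^sub>t v)))) =
    scale (jw_coeff N (Suc l) 0)
      (\<Sum>i<N. \<Sum>j<N. scale (z i j) (JW N (Suc l) (wbasis [i] \<otimes>\<^sub>t contract [j] v)))"
    (is "?L = ?R")
proof -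
  define a where "a = jw_coeff N (Suc l) 0"
  define b where "b i j = (\<Sum>k<l. scale (jw_coeff N (Suc l) (Suc k)) (cup N k (contract [i] (contract [j] v))))" for i j
  have scale_add: "scale c (x + y) = scale c x + scale c y" for c x y
    by (simp add: scale_def fun_eq_iff distrib_left)
  have diag: "(\<Sum>i<N. \<Sum>j<N. scale (z i j) (if i = j then v else 0)) = 0"
  proof -
    have "(\<Sum>i<N. \<Sum>j<N. scale (z i j) (if i = j then v else 0)) = (\<Sum>i<N. \<Sum>j<N. if i = j then scale (z i j) v else 0)"
      by (intro sum.cong) auto
    also have "\<dots> = (\<Sum>i<N. scale (z i i) v)" by simp
    also have "\<dots> = scale (\<Sum>i<N. z i i) v"
      by (simp add: scale_def fun_eq_iff sum_fun_app sum_distrib_right)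
    finally show ?thesis using z by simp
  qed
  have "?L = (\<Sum>i<N. \<Sum>j<N. scale (z i j) (if i = j then v else 0) +
      scale (z i j) (scale a (wbasis [i] \<otimes>\<^sub>t contract [j] v) + b i j))"
    unfolding a_def b_def using contract_JW_create[OF N v] by (intro sum.cong refl) (simp only: scale_add lessThan_iff)
  also have "\<dots> = (\<Sum>i<N. \<Sum>j<N. scale (z i j) (scale a (wbasis [i] \<otimes>\<^sub>t contract [j] v) + b i j))"
    unfolding sum.distrib diag by simp
  finally have L: "?L = \<dots>" .
  have b: "is_proj N (Suc l) (b i j) 0" for i j
  proof -
    have "is_proj N (Suc l) (b i j) (\<Sum>k<l. scale (jw_coeff N (Suc l) (Suc k)) 0)"
      unfolding b_def
    proof (intro is_proj_sum is_proj_scale)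
      fix k assume "k \<in> {..<l}"
      then obtain l' where "l = Suc l'" "k \<le> l'" by (cases l) auto
      then show "is_proj N (Suc l) (cup N k (contract [i] (contract [j] v))) 0"
        by (simp only: is_proj_cup)
    qed
    then show ?thesis by simp
  qed
  have "is_proj N (Suc l) ?L (\<Sum>i<N. \<Sum>j<N. scale (z i j) (scale a (JW N (Suc l) (wbasis [i] \<otimes>\<^sub>t contract [j] v)) + 0))"
    unfolding L using N v b
    by (intro is_proj_sum is_proj_scale is_proj_add JW_is_proj tpow_wbasis_tprod)
      (auto simp: Hsp_contract_single Hsp_tpow)
  \<comment> \<open>Being in H_(l+1), \<open>?L\<close> is its own projection, so uniqueness
    identifies it with the sum just found.\<close>
  moreover have "?L \<in> Hsp N (Suc l)"
    using N v by (intro Hsp_sum Hsp_scale Hsp_contract_single JW_Hsp tpow_wbasis_tprod) (auto simp: Hsp_tpow)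
  ultimately have "?L = (\<Sum>i<N. \<Sum>j<N. scale (z i j) (scale a (JW N (Suc l) (wbasis [i] \<otimes>\<^sub>t contract [j] v)) + 0))"
    using is_proj_unique is_proj_self by blast
  then show ?thesis
    by (simp add: a_def scale_sum scale_scale mult.commute)
qed

text \<open>One contraction passes \<open>q\<close> creations; the factor with index
  \<open>j\<close> belongs to the creation acting on degree \<open>j + l + 1\<close>.\<close>

definition pass_coeff :: "nat \<Rightarrow> nat \<Rightarrow> nat \<Rightarrow> complex" where
  "pass_coeff N q l = (\<Prod>j<q. jw_coeff N (Suc (j + l)) 0)"

lemma tpow_word_tprod: "s \<in> words N q \<Longrightarrow> v \<in> tpow N n \<Longrightarrow> wbasis s \<otimes>\<^sub>t v \<in> tpow N (q + n)"
  by (intro tpow_tprod wbasis_tpow)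

text \<open>Induction on the number of creations. The outermost one is swapped for each fixed tail
  \<open>s\<close>, using the trace of \<zeta> over its first two legs; the contraction then meets
  the other creations with coefficients \<open>contract [i] \<zeta>\<close>, again
  trace-free.\<close>

lemma pass_contract:
  assumes N: "N \<ge> 2" and v: "v \<in> Hsp N (Suc l)"
  shows "\<zeta> \<in> Hsp N (Suc q) \<Longrightarrow>
    (\<Sum>i<N. \<Sum>s\<in>words N q. scale (\<zeta> (i # s)) (contract [i] (JW N (q + Suc l) (wbasis s \<otimes>\<^sub>t v)))) =
    scale (pass_coeff N q l)
      (\<Sum>s\<in>words N q. \<Sum>i<N. scale (\<zeta> (s @ [i])) (JW N (q + l) (wbasis s \<otimes>\<^sub>t contract [i] v)))"
proof (induction q arbitrary: \<zeta>)
  case 0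
  then show ?case
    using v by (simp add: pass_coeff_def JW_Hsp_eq Hsp_contract_single)
next
  case (Suc q)
  define V where "V s = JW N (q + Suc l) (wbasis s \<otimes>\<^sub>t v)" for s
  have V: "V s \<in> Hsp N (Suc (q + l))" if "s \<in> words N q" for s
    using JW_Hsp[OF N tpow_word_tprod[OF that Hsp_tpow[OF v]]] by (simp add: V_def)
  define W where "W s j = JW N (q + l) (wbasis s \<otimes>\<^sub>t contract [j] v)" for s j
  have cv: "contract [j] v \<in> tpow N l" for j
    using v by (simp add: Hsp_contract_single Hsp_tpow)
  have W: "W s j \<in> tpow N (q + l)" if "s \<in> words N q" for s j
    unfolding W_def by (rule Hsp_tpow[OF JW_Hsp[OF N tpow_word_tprod[OF that cv]]])
  have cV: "contract [j] (V s) \<in> tpow N (q + l)" if "s \<in> words N q" for s j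
    using V[OF that] by (simp add: Hsp_contract_single Hsp_tpow)
  let ?c = "jw_coeff N (Suc (q + l)) 0"
  \<comment> \<open>Creations compose: projecting after each new letter has the same effect as one
    projection at the end.\<close>
  have create: "JW N (Suc q + k) (wbasis (j # s) \<otimes>\<^sub>t x) =
      JW N (Suc q + k) (wbasis [j] \<otimes>\<^sub>t JW N (q + k) (wbasis s \<otimes>\<^sub>t x))"
    if "j < N" "s \<in> words N q" "x \<in> tpow N k" for j s k x
    using JW_wbasis_tprod[OF N that(1) tpow_word_tprod[OF that(2,3)]] by (simp add: wbasis_Cons_tprod[of j s])
  have "(\<Sum>i<N. \<Sum>s\<in>words N (Suc q). scale (\<zeta> (i # s)) (contract [i] (JW N (Suc q + Suc l) (wbasis s \<otimes>\<^sub>t v))))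
    = (\<Sum>i<N. \<Sum>j<N. \<Sum>s\<in>words N q. scale (\<zeta> (i # j # s)) (contract [i] (JW N (Suc (Suc (q + l))) (wbasis [j] \<otimes>\<^sub>t V s))))"
    unfolding sum_words_Suc V_def using create[OF _ _ Hsp_tpow[OF v]] by (intro sum.cong refl) simp
  also have "\<dots> = (\<Sum>s\<in>words N q. \<Sum>i<N. \<Sum>j<N. scale (\<zeta> (i # j # s)) (contract [i] (JW N (Suc (Suc (q + l))) (wbasis [j] \<otimes>\<^sub>t V s))))"
    by (subst sum.swap[of _ "words N q"], subst sum.swap[of _ "words N q"], rule refl)
  also have "\<dots> = (\<Sum>s\<in>words N q. scale ?c (\<Sum>i<N. \<Sum>j<N. scale (\<zeta> (i # j # s)) (JW N (Suc (q + l)) (wbasis [i] \<otimes>\<^sub>t contract [j] (V s)))))"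
  proof (intro sum.cong refl swap_contract_create N V)
    fix s assume "s \<in> words N q"
    then show "(\<Sum>i<N. \<zeta> (i # i # s)) = 0"
      using Hsp_trace[OF Suc.prems, of "[]" s] by (simp add: length_words)
  qed
  also have "\<dots> = scale ?c (\<Sum>i<N. \<Sum>j<N. \<Sum>s\<in>words N q. scale (\<zeta> (i # j # s)) (JW N (Suc (q + l)) (wbasis [i] \<otimes>\<^sub>t contract [j] (V s))))"
    unfolding scale_sum[symmetric]
    by (subst sum.swap[of _ _ "words N q"], subst sum.swap[of _ _ "words N q"], rule refl)
  also have "\<dots> = scale ?c (\<Sum>i<N. JW N (Suc (q + l)) (wbasis [i] \<otimes>\<^sub>t
      (\<Sum>j<N. \<Sum>s\<in>words N q. scale (\<zeta> (i # j # s)) (contract [j] (V s)))))"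
    unfolding tprod_sum_right tprod_scale_right using N cV
    by (simp add: JW_sum JW_scale tpow_sum tpow_scale tpow_wbasis_tprod)
  also have "\<dots> = scale ?c (\<Sum>i<N. JW N (Suc (q + l)) (wbasis [i] \<otimes>\<^sub>t
      scale (pass_coeff N q l) (\<Sum>s\<in>words N q. \<Sum>j<N. scale (\<zeta> (i # s @ [j])) (W s j))))"
    using Suc.IH[OF Hsp_contract_single[OF Suc.prems]] by (simp add: V_def W_def contract_single[of _ \<zeta>])
  also have "\<dots> = scale (?c * pass_coeff N q l) (\<Sum>i<N. \<Sum>s\<in>words N q. \<Sum>j<N.
      scale (\<zeta> (i # s @ [j])) (JW N (Suc (q + l)) (wbasis [i] \<otimes>\<^sub>t W s j)))"
    unfolding scale_scale[symmetric] scale_sum[of "pass_coeff N q l" _ "{..<N}"] tprod_sum_right tprod_scale_right using N W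
    by (simp add: JW_sum JW_scale tpow_sum tpow_scale tpow_wbasis_tprod)
  also have "\<dots> = scale (pass_coeff N (Suc q) l)
      (\<Sum>s\<in>words N (Suc q). \<Sum>i<N. scale (\<zeta> (s @ [i])) (JW N (Suc q + l) (wbasis s \<otimes>\<^sub>t contract [i] v)))"
    unfolding sum_words_Suc W_def using create[OF _ _ cv] by (simp add: pass_coeff_def mult.commute)
  finally show ?case .
qed

text \<open>The innermost \<open>p\<close> contractions move first and act on degree
  \<open>p + Suc r\<close>; the last one then meets a vector of degree \<open>Suc r\<close>, which
  explains the shift.\<close>

primrec exchange_coeff :: "nat \<Rightarrow> nat \<Rightarrow> nat \<Rightarrow> nat \<Rightarrow> complex" where
  "exchange_coeff N q 0 r = 1"
| "exchange_coeff N q (Suc p) r = exchange_coeff N q p (Suc r) * pass_coeff N q r"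

text \<open>Induction on the number of contractions: for a fixed outermost letter \<open>i\<close>
  the inner ones move by the induction hypothesis for \<open>contract [i] \<zeta>\<close>, then the
  outermost one by \<open>pass_contract\<close>.\<close>

lemma exchange:
  assumes N: "N \<ge> 2"
  shows "\<zeta> \<in> Hsp N (p + q) \<Longrightarrow> v \<in> Hsp N (p + r) \<Longrightarrow>
    (\<Sum>u\<in>words N p. \<Sum>s\<in>words N q. scale (\<zeta> (u @ s)) (contract u (JW N (q + (p + r)) (wbasis s \<otimes>\<^sub>t v)))) =
    scale (exchange_coeff N q p r)
      (\<Sum>s\<in>words N q. \<Sum>u\<in>words N p. scale (\<zeta> (s @ u)) (JW N (q + r) (wbasis s \<otimes>\<^sub>t contract u v)))"
proof (induction p arbitrary: \<zeta> r)
  case 0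
  then show ?case by simp
next
  case (Suc p)
  define X where "X s u = JW N (q + Suc r) (wbasis s \<otimes>\<^sub>t contract u v)" for s u
  have IH: "(\<Sum>u\<in>words N p. \<Sum>s\<in>words N q. scale (\<zeta> (i # u @ s)) (contract u (JW N (q + (Suc p + r)) (wbasis s \<otimes>\<^sub>t v)))) =
    scale (exchange_coeff N q p (Suc r)) (\<Sum>s\<in>words N q. \<Sum>u\<in>words N p. scale (\<zeta> (i # s @ u)) (X s u))" for i
    using Suc.IH[of "contract [i] \<zeta>" "Suc r", OF Hsp_contract_single] Suc.prems by (simp add: X_def contract_single)
  have pass: "(\<Sum>i<N. \<Sum>s\<in>words N q. scale (\<zeta> (i # s @ u)) (contract [i] (X s u))) =
    scale (pass_coeff N q r)
      (\<Sum>s\<in>words N q. \<Sum>i<N. scale (\<zeta> (s @ i # u)) (JW N (q + r) (wbasis s \<otimes>\<^sub>t contract (i # u) v)))"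
    if u: "u \<in> words N p" for u
  proof -
    have cv: "contract u v \<in> Hsp N (Suc r)"
      using Hsp_contract[of v N u "Suc r"] Suc.prems(2) u by (simp add: length_words)
    \<comment> \<open>Fixing the last legs of \<zeta> keeps it trace-free in the first
      \<open>Suc q\<close> legs, as needed for \<open>pass_contract\<close>.\<close>
    have "(\<lambda>w. \<zeta> (w @ u)) \<in> Hsp N (Suc q)"
    proof (rule HspI)
      have "\<zeta> (w @ u) = 0" if "w \<notin> words N (Suc q)" for w
      proof -
        have "w @ u \<notin> words N (Suc p + q)"
          using that u by (auto simp: words_def)
        then show ?thesis using tpowD[OF Hsp_tpow[OF Suc.prems(1)]] by blast
      qed
      then show "(\<lambda>w. \<zeta> (w @ u)) \<in> tpow N (Suc q)" by (simp add: tpow_def)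
      fix x w :: "nat list" assume "length x + length w + 2 = Suc q"
      then show "(\<Sum>i<N. \<zeta> ((x @ i # i # w) @ u)) = 0"
        using Hsp_trace[OF Suc.prems(1), of x "w @ u"] u by (simp add: length_words)
    qed
    from pass_contract[OF N cv this] show ?thesis
      by (simp add: X_def contract_Cons[of _ u])
  qed
  have "(\<Sum>u\<in>words N (Suc p). \<Sum>s\<in>words N q. scale (\<zeta> (u @ s)) (contract u (JW N (q + (Suc p + r)) (wbasis s \<otimes>\<^sub>t v))))
    = (\<Sum>i<N. contract [i] (\<Sum>u\<in>words N p. \<Sum>s\<in>words N q. scale (\<zeta> (i # u @ s)) (contract u (JW N (q + (Suc p + r)) (wbasis s \<otimes>\<^sub>t v)))))"
    unfolding sum_words_Suc contract_sum contract_scale contract_Cons[symmetric] by simp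
  also have "\<dots> = scale (exchange_coeff N q p (Suc r)) (\<Sum>i<N. \<Sum>s\<in>words N q. \<Sum>u\<in>words N p. scale (\<zeta> (i # s @ u)) (contract [i] (X s u)))"
    unfolding IH contract_sum contract_scale scale_sum ..
  also have "\<dots> = scale (exchange_coeff N q p (Suc r)) (\<Sum>u\<in>words N p. \<Sum>i<N. \<Sum>s\<in>words N q. scale (\<zeta> (i # s @ u)) (contract [i] (X s u)))"
    by (subst sum.swap[of _ "words N p" "words N q"], subst sum.swap[of _ "words N p" "{..<N}"], rule refl)
  also have "\<dots> = scale (exchange_coeff N q p (Suc r)) (\<Sum>u\<in>words N p. scale (pass_coeff N q r)
      (\<Sum>s\<in>words N q. \<Sum>i<N. scale (\<zeta> (s @ i # u)) (JW N (q + r) (wbasis s \<otimes>\<^sub>t contract (i # u) v))))"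
    by (simp add: pass)
  also have "\<dots> = scale (exchange_coeff N q (Suc p) r)
      (\<Sum>s\<in>words N q. \<Sum>u\<in>words N (Suc p). scale (\<zeta> (s @ u)) (JW N (q + r) (wbasis s \<otimes>\<^sub>t contract u v)))"
    unfolding scale_sum[symmetric] scale_scale sum_words_Suc exchange_coeff.simps
    by (subst sum.swap[of _ "words N q" "words N p"], subst sum.swap[of _ "{..<N}" "words N p"], rule refl)
  finally show ?case .
qed

section \<open>Bounds for the scalars\<close>

text \<open>The modulus is [m+1]/[m+2]. Monotonicity of the quantum integers bounds it above; [m+2]
  \<le> N [m+1] bounds it below.\<close>

lemma jw_coeff_0_bounds:
  assumes "N \<ge> 2"
  shows "1 / real N \<le> cmod (jw_coeff N (Suc m) 0)" "cmod (jw_coeff N (Suc m) 0) \<le> 1"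
proof -
  have pos: "0 < qn N (Suc m)" "0 < qn N (Suc (Suc m))" using assms by (simp_all only: qn_pos zero_less_Suc)
  then have eq: "cmod (jw_coeff N (Suc m) 0) = qn N (Suc m) / qn N (Suc (Suc m))"
    by (simp add: jw_coeff_def norm_divide del: qn.simps flip: of_real_divide)
  have "qn N (Suc (Suc m)) \<le> real N * qn N (Suc m)" using assms by (simp only: qn_Suc_le zero_less_Suc)
  then show "1 / real N \<le> cmod (jw_coeff N (Suc m) 0)"
    unfolding eq using pos assms by (simp add: field_simps del: qn.simps)
  have "qn N (Suc m) \<le> qn N (Suc (Suc m))" using qn_mono_step[OF assms, of "Suc m"] by simp
  then show "cmod (jw_coeff N (Suc m) 0) \<le> 1"
    unfolding eq using pos by (simp del: qn.simps)
qed

lemma pass_coeff_bounds: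
  assumes "N \<ge> 2"
  shows "(1 / real N) ^ q \<le> cmod (pass_coeff N q l)" "cmod (pass_coeff N q l) \<le> 1"
proof -
  have eq: "cmod (pass_coeff N q l) = (\<Prod>j<q. cmod (jw_coeff N (Suc (j + l)) 0))"
    by (simp add: pass_coeff_def prod_norm)
  have "(\<Prod>j<q. 1 / real N) \<le> cmod (pass_coeff N q l)"
    unfolding eq by (rule prod_mono) (simp add: jw_coeff_0_bounds[OF assms])
  then show "(1 / real N) ^ q \<le> cmod (pass_coeff N q l)" by simp
  show "cmod (pass_coeff N q l) \<le> 1"
    unfolding eq by (rule prod_le_1) (simp add: jw_coeff_0_bounds[OF assms])
qed

lemma exchange_coeff_bounds:
  assumes "N \<ge> 2"
  shows "((1 / real N) ^ q) ^ p \<le> cmod (exchange_coeff N q p r) \<and> cmod (exchange_coeff N q p r) \<le> 1"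
proof (induction p arbitrary: r)
  case (Suc p)
  have "((1 / real N) ^ q) ^ p * (1 / real N) ^ q \<le> cmod (exchange_coeff N q p (Suc r)) * cmod (pass_coeff N q r)"
    using Suc by (intro mult_mono pass_coeff_bounds assms) auto
  moreover have "cmod (exchange_coeff N q p (Suc r)) * cmod (pass_coeff N q r) \<le> 1"
    using Suc by (intro mult_le_one pass_coeff_bounds assms) auto
  ultimately show ?case
    by (simp add: norm_mult mult.commute)
qed auto

text \<open>The scalar is real, so the conjugate-linear reversal fixes it and both identities share
  it.\<close>

lemma cnj_exchange_coeff: "cnj (exchange_coeff N q p r) = exchange_coeff N q p r"
  by (induction p arbitrary: r) (simp_all add: pass_coeff_def jw_coeff_def)

section \<open>The conjugate-linear reversal of the legs\<close>

lemma tconj_tconj [simp]: "tconj (tconj v) = v"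
  by (simp add: tconj_def)

lemma tconj_tpow: "v \<in> tpow N n \<Longrightarrow> tconj v \<in> tpow N n"
  by (simp add: tpow_def tconj_def)

lemma tconj_diff: "tconj (x - y) = tconj x - tconj y"
  by (simp add: tconj_def fun_eq_iff)

lemma tconj_sum: "tconj (\<Sum>a\<in>A. f a) = (\<Sum>a\<in>A. tconj (f a))"
  by (simp add: tconj_def fun_eq_iff sum_fun_app)

lemma tconj_scale: "tconj (scale c v) = scale (cnj c) (tconj v)"
  by (simp add: tconj_def scale_def)

lemma tconj_wbasis: "tconj (wbasis u) = wbasis (rev u)"
  by (auto simp: tconj_def wbasis_def fun_eq_iff)

lemma tconj_tprod: "tconj (x \<otimes>\<^sub>t y) = tconj y \<otimes>\<^sub>t tconj x"
proof
  fix w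
  show "tconj (x \<otimes>\<^sub>t y) w = (tconj y \<otimes>\<^sub>t tconj x) w"
    unfolding tconj_def tprod_def cnj_sum
    by (rule sum.reindex_bij_witness[of _ "\<lambda>k. length w - k" "\<lambda>k. length w - k"])
      (auto simp: take_rev drop_rev mult.commute)
qed

lemma tinner_tconj: "tinner N n (tconj x) y = cnj (tinner N n x (tconj y))"
  unfolding tinner_def tconj_def
  by (subst sum_words_rev[symmetric]) simp

lemma tconj_Hsp: "v \<in> Hsp N n \<Longrightarrow> tconj v \<in> Hsp N n"
proof (rule HspI)
  assume v: "v \<in> Hsp N n"
  then show "tconj v \<in> tpow N n" by (simp add: tconj_tpow Hsp_tpow)
  fix u w :: "nat list" assume "length u + length w + 2 = n"
  then show "(\<Sum>i<N. tconj v (u @ i # i # w)) = 0"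
    using Hsp_trace[OF v, of "rev w" "rev u"] by (simp add: tconj_def flip: cnj_sum)
qed

text \<open>Reversal preserves H_n and conjugates inner products, so it maps the projection of
  \<open>v\<close> to that of \<open>tconj v\<close>.\<close>

lemma tconj_JW:
  assumes "N \<ge> 2" "v \<in> tpow N n"
  shows "JW N n (tconj v) = tconj (JW N n v)"
proof (rule JW_eqI)
  have "is_proj N n v (JW N n v)" using assms by (rule JW_is_proj)
  then show "is_proj N n (tconj v) (tconj (JW N n v))"
    by (auto simp: is_proj_def tconj_Hsp tinner_tconj simp flip: tconj_diff)
qed

text \<open>On basis words the reversal exchanges the two tensor factors, and the two conjugations
  cancel on the coefficients. This reduces operators on the last legs to operators on the
  first.\<close>

lemma op_tensor_mirror:
  "op_tensor N r p id T v = tconj (op_tensor N p r (tconj \<circ> T \<circ> tconj) id (tconj v))"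
proof -
  have "tconj (op_tensor N p r (tconj \<circ> T \<circ> tconj) id (tconj v)) =
    (\<Sum>w\<in>words N p. \<Sum>u\<in>words N r. scale (v (rev u @ rev w)) (wbasis (rev u) \<otimes>\<^sub>t T (wbasis (rev w))))"
    by (simp add: op_tensor_def tconj_sum tconj_scale tconj_tprod tconj_wbasis tconj_def[of v])
  also have "\<dots> = (\<Sum>w\<in>words N p. \<Sum>u\<in>words N r. scale (v (u @ rev w)) (wbasis u \<otimes>\<^sub>t T (wbasis (rev w))))"
    by (intro sum.cong refl sum_words_rev)
  also have "\<dots> = (\<Sum>w\<in>words N p. \<Sum>u\<in>words N r. scale (v (u @ w)) (wbasis u \<otimes>\<^sub>t T (wbasis w)))"
    by (rule sum_words_rev[where f = "\<lambda>w. \<Sum>u\<in>words N r. scale (v (u @ w)) (wbasis u \<otimes>\<^sub>t T (wbasis w))"])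
  finally show ?thesis by (simp add: op_tensor_def sum.swap[of _ "words N p"])
qed

lemma tconj_bra: "tconj \<circ> bra N n \<xi> \<circ> tconj = bra N n (tconj \<xi>)"
  by (simp add: fun_eq_iff bra_def tconj_scale tconj_wbasis tinner_tconj)

lemma tconj_ket: "tconj \<circ> ket \<xi> \<circ> tconj = ket (tconj \<xi>)"
  by (simp add: fun_eq_iff ket_def tconj_scale) (simp add: tconj_def)

lemma tconj_ket_bra: "tconj \<circ> (ket x \<circ> bra N n \<xi>) \<circ> tconj = ket (tconj x) \<circ> bra N n (tconj \<xi>)"
  by (simp add: fun_eq_iff flip: tconj_bra tconj_ket)

section \<open>Sweedler decompositions in coordinates\<close>

text \<open>The conjugation in \<open>tconj\<close> cancels that of the bra, and its reversal
  matches the one in \<open>contract\<close>, so the coefficients of \<open>x\<close> appear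
  unchanged.\<close>

lemma contract_bra_expand:
  "(\<lambda>w. \<Sum>u\<in>words N p. cnj (tconj x u) * v (u @ w)) = (\<Sum>u\<in>words N p. scale (x u) (contract u v))"
proof
  fix w
  have "(\<Sum>u\<in>words N p. cnj (tconj x u) * v (u @ w)) = (\<Sum>u\<in>words N p. x u * v (rev u @ w))"
    unfolding tconj_def by (subst sum_words_rev[symmetric]) simp
  then show "(\<Sum>u\<in>words N p. cnj (tconj x u) * v (u @ w)) = (\<Sum>u\<in>words N p. scale (x u) (contract u v)) w"
    by (simp add: sum_fun_app scale_def contract_def)
qed

lemma tprod_expand: "x \<in> tpow N a \<Longrightarrow> x \<otimes>\<^sub>t v = (\<Sum>s\<in>words N a. scale (x s) (wbasis s \<otimes>\<^sub>t v))"
  by (subst tpow_expand[of x N a]) (simp_all add: tprod_sum_left tprod_scale_left)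

text \<open>Through this formula both sides of the identities depend on \<zeta> only, whatever
  decomposition is chosen.\<close>

lemma decomp_append:
  assumes "decomp N a b \<zeta> m x y" "length u = a"
  shows "\<zeta> (u @ w) = (\<Sum>k<m. x k u * y k w)"
proof -
  have "(x k \<otimes>\<^sub>t y k) (u @ w) = x k u * y k w" if "k < m" for k
    using assms that by (intro tprod_append[of _ N a]) (simp_all add: decomp_def Hsp_tpow)
  then show ?thesis using assms by (simp add: decomp_def sum_fun_app)
qed

lemma contract_JW_decomp:
  assumes N: "N \<ge> 2" and d: "decomp N p q \<zeta> m x y" and v: "v \<in> tpow N (p + r)"
  shows "(\<Sum>k<m. op_tensor N p (q + r) (bra N p (tconj (x k))) id
        (JW N (q + (p + r)) (op_tensor N 0 (p + r) (ket (y k)) id v))) =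
    (\<Sum>u\<in>words N p. \<Sum>s\<in>words N q. scale (\<zeta> (u @ s)) (contract u (JW N (q + (p + r)) (wbasis s \<otimes>\<^sub>t v))))"
proof -
  define Y where "Y s = JW N (q + (p + r)) (wbasis s \<otimes>\<^sub>t v)" for s
  have "op_tensor N p (q + r) (bra N p (tconj (x k))) id (JW N (q + (p + r)) (op_tensor N 0 (p + r) (ket (y k)) id v))
     = (\<Sum>u\<in>words N p. \<Sum>s\<in>words N q. scale (x k u * y k s) (contract u (Y s)))" if "k < m" for k
  proof -
    have y: "y k \<in> tpow N q" using d that by (simp add: decomp_def Hsp_tpow)
    have "JW N (q + (p + r)) (y k \<otimes>\<^sub>t v) \<in> tpow N (q + (p + r))"
      by (rule Hsp_tpow[OF JW_Hsp[OF N tpow_tprod[OF y v]]])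
    \<comment> \<open>The same degree is regrouped as \<open>p + (q + r)\<close>, since the bra acts
      on the first \<open>p\<close> legs.\<close>
    then have t: "JW N (q + (p + r)) (y k \<otimes>\<^sub>t v) \<in> tpow N (p + (q + r))" by (simp add: ac_simps)
    have "JW N (q + (p + r)) (y k \<otimes>\<^sub>t v) = (\<Sum>s\<in>words N q. scale (y k s) (Y s))"
      unfolding tprod_expand[OF y] Y_def using N v
      by (simp add: JW_sum JW_scale tpow_scale tpow_word_tprod)
    then show ?thesis
      using op_tensor_bra[OF t] by (simp add: op_tensor_ket[OF v] contract_bra_expand contract_sum contract_scale scale_sum scale_scale)
  qed
  then have "(\<Sum>k<m. op_tensor N p (q + r) (bra N p (tconj (x k))) id
        (JW N (q + (p + r)) (op_tensor N 0 (p + r) (ket (y k)) id v))) =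
     (\<Sum>k<m. \<Sum>u\<in>words N p. \<Sum>s\<in>words N q. scale (x k u * y k s) (contract u (Y s)))" by simp
  also have "\<dots> = (\<Sum>u\<in>words N p. \<Sum>s\<in>words N q. \<Sum>k<m. scale (x k u * y k s) (contract u (Y s)))"
    by (subst sum.swap[of _ "words N p"], intro sum.cong refl, rule sum.swap)
  also have "\<dots> = (\<Sum>u\<in>words N p. \<Sum>s\<in>words N q. scale (\<zeta> (u @ s)) (contract u (Y s)))"
    by (intro sum.cong refl)
      (simp add: decomp_append[OF d length_words] fun_eq_iff sum_fun_app scale_def sum_distrib_right)
  finally show ?thesis by (simp add: Y_def)
qed

lemma JW_ket_bra_decomp:
  assumes N: "N \<ge> 2" and d: "decomp N q p \<zeta> m x y" and v: "v \<in> Hsp N (p + r)"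
  shows "(\<Sum>k<m. JW N (q + r) (op_tensor N p r (ket (x k) \<circ> bra N p (tconj (y k))) id (JW N (p + r) v))) =
    (\<Sum>s\<in>words N q. \<Sum>u\<in>words N p. scale (\<zeta> (s @ u)) (JW N (q + r) (wbasis s \<otimes>\<^sub>t contract u v)))"
proof -
  define Y where "Y s u = JW N (q + r) (wbasis s \<otimes>\<^sub>t contract u v)" for s u
  have cv: "contract u v \<in> tpow N r" if "u \<in> words N p" for u
    using tpow_contract[of v N u r] Hsp_tpow[OF v] that by (simp add: length_words)
  have "JW N (q + r) (op_tensor N p r (ket (x k) \<circ> bra N p (tconj (y k))) id (JW N (p + r) v))
     = (\<Sum>s\<in>words N q. \<Sum>u\<in>words N p. scale (x k s * y k u) (Y s u))" if "k < m" for k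
  proof -
    have x: "x k \<in> tpow N q" using d that by (simp add: decomp_def Hsp_tpow)
    show ?thesis
      unfolding JW_Hsp_eq[OF v] op_tensor_ket_bra[OF Hsp_tpow[OF v]] contract_bra_expand tprod_expand[OF x] Y_def
      using N cv
      by (simp add: tprod_sum_right tprod_scale_right JW_sum JW_scale tpow_sum tpow_scale tpow_word_tprod scale_sum scale_scale)
  qed
  then have "(\<Sum>k<m. JW N (q + r) (op_tensor N p r (ket (x k) \<circ> bra N p (tconj (y k))) id (JW N (p + r) v))) =
     (\<Sum>k<m. \<Sum>s\<in>words N q. \<Sum>u\<in>words N p. scale (x k s * y k u) (Y s u))" by simp
  also have "\<dots> = (\<Sum>s\<in>words N q. \<Sum>u\<in>words N p. \<Sum>k<m. scale (x k s * y k u) (Y s u))"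
    by (subst sum.swap[of _ "words N q"], intro sum.cong refl, rule sum.swap)
  also have "\<dots> = (\<Sum>s\<in>words N q. \<Sum>u\<in>words N p. scale (\<zeta> (s @ u)) (Y s u))"
    by (intro sum.cong refl)
      (simp add: decomp_append[OF d length_words] fun_eq_iff sum_fun_app scale_def sum_distrib_right)
  finally show ?thesis by (simp add: Y_def)
qed

section \<open>The two operator identities\<close>

lemma exchange_left:
  assumes "N \<ge> 2" "\<zeta> \<in> Hsp N (p + q)" "decomp N p q \<zeta> m x y" "decomp N q p \<zeta> m' x' y'" "v \<in> Hsp N (p + r)"
  shows "(\<Sum>k<m. op_tensor N p (q + r) (bra N p (tconj (x k))) id
        (JW N (q + (p + r)) (op_tensor N 0 (p + r) (ket (y k)) id v))) =
    scale (exchange_coeff N q p r)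
      (\<Sum>k<m'. JW N (q + r) (op_tensor N p r (ket (x' k) \<circ> bra N p (tconj (y' k))) id (JW N (p + r) v)))"
  using exchange[OF assms(1,2,5)] contract_JW_decomp[OF assms(1,3) Hsp_tpow[OF assms(5)]]
    JW_ket_bra_decomp[OF assms(1,4,5)] by simp

text \<open>Both sides are mirror images of those in \<open>exchange_left\<close> taken at
  \<open>tconj v\<close>, so the reversal is applied to that identity.\<close>

lemma exchange_right:
  assumes N: "N \<ge> 2" and \<zeta>: "\<zeta> \<in> Hsp N (p + q)" and d: "decomp N p q \<zeta> m x y" and d': "decomp N q p \<zeta> m' x' y'"
    and v: "v \<in> Hsp N (p + r)"
  shows "(\<Sum>k<m. op_tensor N (q + r) p id (bra N p (x k))
        (JW N (q + (p + r)) (op_tensor N (p + r) 0 id (ket (tconj (y k))) v))) =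
    scale (exchange_coeff N q p r)
      (\<Sum>k<m'. JW N (q + r) (op_tensor N r p id (ket (tconj (x' k)) \<circ> bra N p (y' k)) (JW N (p + r) v)))"
proof -
  have vt: "tconj v \<in> tpow N (p + r)" using v by (simp add: tconj_tpow Hsp_tpow)
  have L: "op_tensor N (q + r) p id (bra N p (x k))
        (JW N (q + (p + r)) (op_tensor N (p + r) 0 id (ket (tconj (y k))) v)) =
     tconj (op_tensor N p (q + r) (bra N p (tconj (x k))) id
        (JW N (q + (p + r)) (op_tensor N 0 (p + r) (ket (y k)) id (tconj v))))" if "k < m" for k
  proof -
    have "y k \<in> tpow N q" using d that by (simp add: decomp_def Hsp_tpow)
    then have t: "op_tensor N 0 (p + r) (ket (y k)) id (tconj v) \<in> tpow N (q + (p + r))"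
      unfolding op_tensor_ket[OF vt] using vt by (rule tpow_tprod)
    show ?thesis
      unfolding op_tensor_mirror tconj_bra tconj_ket tconj_tconj tconj_JW[OF N t] ..
  qed
  have R: "JW N (q + r) (op_tensor N r p id (ket (tconj (x' k)) \<circ> bra N p (y' k)) (JW N (p + r) v)) =
    tconj (JW N (q + r) (op_tensor N p r (ket (x' k) \<circ> bra N p (tconj (y' k))) id (JW N (p + r) (tconj v))))"
    if "k < m'" for k
  proof -
    have x: "x' k \<in> tpow N q" using d' that by (simp add: decomp_def Hsp_tpow)
    have w: "JW N (p + r) (tconj v) \<in> tpow N (p + r)"
      by (rule Hsp_tpow[OF JW_Hsp[OF N vt]])
    have c: "contract u (JW N (p + r) (tconj v)) \<in> tpow N r" if "u \<in> words N p" for u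
      using tpow_contract[of _ N u r] w that by (simp add: length_words)
    have t: "op_tensor N p r (ket (x' k) \<circ> bra N p (tconj (y' k))) id (JW N (p + r) (tconj v)) \<in> tpow N (q + r)"
      unfolding op_tensor_ket_bra[OF w] contract_bra_expand using x c by (intro tpow_tprod tpow_sum tpow_scale)
    show ?thesis
      using tconj_JW[OF N t]
      unfolding op_tensor_mirror tconj_ket_bra tconj_tconj tconj_JW[OF N Hsp_tpow[OF v]] .
  qed
  show ?thesis
    using arg_cong[OF exchange_left[OF N \<zeta> d d' tconj_Hsp[OF v]], of tconj]
    by (simp add: L R tconj_sum tconj_scale cnj_exchange_coeff)
qed

theorem lemma3p4:
  fixes N p q :: nat
  assumes "N \<ge> 2"
  shows "\<exists>C::real. C > 0 \<and> (\<exists>\<alpha> :: nat \<Rightarrow> complex. \<forall>n \<ge> p + q.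
    C \<le> cmod (\<alpha> n) \<and> cmod (\<alpha> n) \<le> 1 \<and>
    (\<forall>\<zeta> \<in> Hsp N (p + q). \<forall>m x y m' x' y'.
       decomp N p q \<zeta> m x y \<longrightarrow> decomp N q p \<zeta> m' x' y' \<longrightarrow>
       (\<forall>v \<in> Hsp N (n - q).
          (\<Sum>k<m. op_tensor N p (n - p) (bra N p (tconj (x k))) id \<circ> JW N n \<circ>
                  op_tensor N 0 (n - q) (ket (y k)) id) v
          = scale (\<alpha> n)
            ((\<Sum>k<m'. JW N (n - p) \<circ>
                  op_tensor N p (n - p - q) (ket (x' k) \<circ> bra N p (tconj (y' k))) id \<circ>
                  JW N (n - q)) v)) \<and>
       (\<forall>v \<in> Hsp N (n - q).
          (\<Sum>k<m. op_tensor N (n - p) p id (bra N p (x k)) \<circ> JW N n \<circ>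
                  op_tensor N (n - q) 0 id (ket (tconj (y k)))) v
          = scale (\<alpha> n)
            ((\<Sum>k<m'. JW N (n - p) \<circ>
                  op_tensor N (n - p - q) p id (ket (tconj (x' k)) \<circ> bra N p (y' k)) \<circ>
                  JW N (n - q)) v))))"
proof (intro exI[of _ "((1 / real N) ^ q) ^ p"] exI[of _ "\<lambda>n. exchange_coeff N q p (n - p - q)"] conjI allI impI ballI)
  \<comment> \<open>The constant is N^(-pq), one factor 1/N per swap; the scalar for
    \<open>n\<close> has \<open>r = n - p - q\<close>, so the bound is uniform in
    \<open>n\<close>.\<close>
  show "((1 / real N) ^ q) ^ p > 0" using assms by simp
next
  fix n assume "n \<ge> p + q"
  show "((1 / real N) ^ q) ^ p \<le> cmod (exchange_coeff N q p (n - p - q))"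
    using exchange_coeff_bounds[OF assms] by blast
next
  fix n assume "n \<ge> p + q"
  show "cmod (exchange_coeff N q p (n - p - q)) \<le> 1"
    using exchange_coeff_bounds[OF assms] by blast
next
  fix n \<zeta> m x y m' x' y' v
  assume n: "n \<ge> p + q" and *: "\<zeta> \<in> Hsp N (p + q)" "decomp N p q \<zeta> m x y" "decomp N q p \<zeta> m' x' y'"
    and v: "v \<in> Hsp N (n - q)"
  define r where "r = n - p - q"
  have r: "n - p = q + r" "n - q = p + r" "n = q + (p + r)" using n by (simp_all add: r_def)
  then have v': "v \<in> Hsp N (p + r)" using v by simp
  \<comment> \<open>The type instance of \<open>sum_fun_app\<close> evaluates sums of operators at a
    tensor, while sums of tensors stay unevaluated.\<close>
  show "(\<Sum>k<m. op_tensor N p (n - p) (bra N p (tconj (x k))) id \<circ> JW N n \<circ>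
                  op_tensor N 0 (n - q) (ket (y k)) id) v
          = scale (exchange_coeff N q p (n - p - q))
            ((\<Sum>k<m'. JW N (n - p) \<circ>
                  op_tensor N p (n - p - q) (ket (x' k) \<circ> bra N p (tconj (y' k))) id \<circ>
                  JW N (n - q)) v)"
    using exchange_left[OF assms * v']
    unfolding r(1,2) add_diff_cancel_left' sum_fun_app[where 'b = tens] comp_apply by (simp only: r(3)[symmetric])
  show "(\<Sum>k<m. op_tensor N (n - p) p id (bra N p (x k)) \<circ> JW N n \<circ>
                  op_tensor N (n - q) 0 id (ket (tconj (y k)))) v
          = scale (exchange_coeff N q p (n - p - q))
            ((\<Sum>k<m'. JW N (n - p) \<circ>
                  op_tensor N (n - p - q) p id (ket (tconj (x' k)) \<circ> bra N p (y' k)) \<circ>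
                  JW N (n - q)) v)"
    using exchange_right[OF assms * v']
    unfolding r(1,2) add_diff_cancel_left' sum_fun_app[where 'b = tens] comp_apply by (simp only: r(3)[symmetric])
qed

end
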